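(* Let $\mathfrak{H}$ be a complex Hilbert space and let $\mathfrak{a}$ be a densely defined, positive definite, closed symmetric sesquilinear form in $\mathfrak{H}$. Let $A$ be the associated self-adjoint operator. Suppose that $\mathfrak{b}$ is a symmetric $\mathfrak{a}$-bounded coercive sesquilinear form on $\operatorname{Dom}[\mathfrak{b}]=\operatorname{Dom}[\mathfrak{a}]$, that is, $$|\mathfrak{b}[x,y]|\le\beta\,\mathfrak{a}[x,x]^{1/2}\,\mathfrak{a}[y,y]^{1/2}\quad\text{for all } x,y\in\operatorname{Dom}[\mathfrak{b}],$$ and $$|\mathfrak{b}[x,x]|\ge\alpha\,\mathfrak{a}[x,x]\quad\text{for all } x\in\operatorname{Dom}[\mathfrak{b}],$$ for some $0<\alpha\le\beta$. Then there is a unique bounded and boundedly invertible self-adjoint operator $H$ in $\mathfrak{H}$ such that the form $\mathfrak{b}$ admits the representation $$\mathfrak{b}[x,y]=\langle A^{1/2}x,HA^{1/2}y\rangle,\qquad x,y\in\operatorname{Dom}[\mathfrak{b}]=\operatorname{Dom}(A^{1/2}).$$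
   Context: Inner products and sesquilinear forms are linear in the second argument and conjugate-linear in the first. Positive definite means that there is $c>0$ with $\mathfrak{a}[x,x]\ge c\|x\|^2$ for all $x\in\operatorname{Dom}[\mathfrak{a}]$. The operator $A$ associated with $\mathfrak{a}$ is the self-adjoint operator given by the classical first representation theorem, so that $\operatorname{Dom}[\mathfrak{a}]=\operatorname{Dom}(A^{1/2})$ and $\mathfrak{a}[x,y]=\langle A^{1/2}x,A^{1/2}y\rangle$. *)

theory Defs
  imports "HOL-Analysis.Analysis"
begin

text \<open>
  Complex inner product spaces; the inner product is conjugate-linear in the first and linear in
  the second argument. The last axiom makes \<^term>\<open>norm\<close> the norm induced by it; positive
  definiteness is then inherited from \<^class>\<open>real_normed_vector\<close>.
\<close>

class scaleC =
  fixes scaleC :: "complex \<Rightarrow> 'a \<Rightarrow> 'a" (infixr "*\<^sub>C" 75)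

class complex_inner = real_normed_vector + scaleC +
  fixes cinner :: "'a \<Rightarrow> 'a \<Rightarrow> complex"
  assumes scaleC_add_right: "c *\<^sub>C (x + y) = c *\<^sub>C x + c *\<^sub>C y"
    and scaleC_add_left: "(c + d) *\<^sub>C x = c *\<^sub>C x + d *\<^sub>C x"
    and scaleC_scaleC: "c *\<^sub>C d *\<^sub>C x = (c * d) *\<^sub>C x"
    and scaleR_scaleC: "r *\<^sub>R x = complex_of_real r *\<^sub>C x"
    and cinner_commute: "cinner x y = cnj (cinner y x)"
    and cinner_add_right: "cinner x (y + z) = cinner x y + cinner x z"
    and cinner_scaleC_right: "cinner x (c *\<^sub>C y) = c * cinner x y"
    and cinner_self: "cinner x x = complex_of_real ((norm x)\<^sup>2)"

class chilbert_space = complex_inner + complete_space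
begin
subclass banach ..
end

instantiation complex :: chilbert_space
begin
definition scaleC_complex :: "complex \<Rightarrow> complex \<Rightarrow> complex" where
  "scaleC_complex c x = c * x"
definition cinner_complex :: "complex \<Rightarrow> complex \<Rightarrow> complex" where
  "cinner_complex x y = cnj x * y"
instance
  by standard
    (auto simp: scaleC_complex_def cinner_complex_def algebra_simps scaleR_conv_of_real
      complex_norm_square simp flip: of_real_power)
end

definition csubspace :: "'a::complex_inner set \<Rightarrow> bool" where
  "csubspace D \<longleftrightarrow>
     0 \<in> D \<and> (\<forall>x\<in>D. \<forall>y\<in>D. x + y \<in> D) \<and> (\<forall>c. \<forall>x\<in>D. c *\<^sub>C x \<in> D)"

text \<open>
  An operator with a domain is a partial function: its domain is \<^term>\<open>dom T\<close>, its value at a point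
  \<open>x\<close> of the domain is \<^term>\<open>the (T x)\<close>, equality includes equality of the domains, and
  \<open>S \<circ>\<^sub>m T\<close> is the composition on the natural domain.
\<close>

type_synonym 'a partial_op = "'a \<rightharpoonup> 'a"

definition linear_op :: "'a::complex_inner partial_op \<Rightarrow> bool" where
  "linear_op T \<longleftrightarrow> csubspace (dom T) \<and>
     (\<forall>x\<in>dom T. \<forall>y\<in>dom T. the (T (x + y)) = the (T x) + the (T y)) \<and>
     (\<forall>c. \<forall>x\<in>dom T. the (T (c *\<^sub>C x)) = c *\<^sub>C the (T x))"

text \<open>In the next definition the witness is unique when the domain of the operator is dense.\<close>

definition op_adjoint :: "'a::complex_inner partial_op \<Rightarrow> 'a partial_op" where
  "op_adjoint T y =
     (if \<exists>z. \<forall>x\<in>dom T. cinner z x = cinner y (the (T x))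
      then Some (THE z. \<forall>x\<in>dom T. cinner z x = cinner y (the (T x)))
      else None)"

definition self_adjoint :: "'a::complex_inner partial_op \<Rightarrow> bool" where
  "self_adjoint T \<longleftrightarrow> linear_op T \<and> closure (dom T) = UNIV \<and> op_adjoint T = T"

text \<open>Only used for self-adjoint operators, whose quadratic form is real.\<close>

definition nonneg_op :: "'a::complex_inner partial_op \<Rightarrow> bool" where
  "nonneg_op T \<longleftrightarrow> (\<forall>x\<in>dom T. 0 \<le> Re (cinner x (the (T x))))"

definition op_sqrt :: "'a::complex_inner partial_op \<Rightarrow> 'a partial_op" where
  "op_sqrt T = (THE S. self_adjoint S \<and> nonneg_op S \<and> S \<circ>\<^sub>m S = T)"

definition bounded_clinear :: "('a::complex_inner \<Rightarrow> 'a) \<Rightarrow> bool" where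
  "bounded_clinear H \<longleftrightarrow> bounded_linear H \<and> (\<forall>c x. H (c *\<^sub>C x) = c *\<^sub>C H x)"

definition boundedly_invertible :: "('a::complex_inner \<Rightarrow> 'a) \<Rightarrow> bool" where
  "boundedly_invertible H \<longleftrightarrow> (\<exists>K. bounded_clinear K \<and> H \<circ> K = id \<and> K \<circ> H = id)"

text \<open>
  A form is given by its domain \<open>D\<close> and a function of which only the values on \<open>D \<times> D\<close> matter.
\<close>

definition sesquilinear_form :: "'a::complex_inner set \<Rightarrow> ('a \<Rightarrow> 'a \<Rightarrow> complex) \<Rightarrow> bool" where
  "sesquilinear_form D a \<longleftrightarrow> csubspace D \<and>
     (\<forall>x\<in>D. \<forall>y\<in>D. \<forall>z\<in>D. a x (y + z) = a x y + a x z \<and> a (x + y) z = a x z + a y z) \<and>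
     (\<forall>c. \<forall>x\<in>D. \<forall>y\<in>D. a x (c *\<^sub>C y) = c * a x y \<and> a (c *\<^sub>C x) y = cnj c * a x y)"

definition symmetric_form :: "'a::complex_inner set \<Rightarrow> ('a \<Rightarrow> 'a \<Rightarrow> complex) \<Rightarrow> bool" where
  "symmetric_form D a \<longleftrightarrow> (\<forall>x\<in>D. \<forall>y\<in>D. a x y = cnj (a y x))"

text \<open>For a symmetric form \<open>a x x\<close> is real, so that its real part is the value itself.\<close>

definition positive_definite_form :: "'a::complex_inner set \<Rightarrow> ('a \<Rightarrow> 'a \<Rightarrow> complex) \<Rightarrow> bool" where
  "positive_definite_form D a \<longleftrightarrow> (\<exists>c>0. \<forall>x\<in>D. c * (norm x)\<^sup>2 \<le> Re (a x x))"

definition closed_form :: "'a::complex_inner set \<Rightarrow> ('a \<Rightarrow> 'a \<Rightarrow> complex) \<Rightarrow> bool" where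
  "closed_form D a \<longleftrightarrow>
     (\<forall>u x. (\<forall>n::nat. u n \<in> D) \<and> u \<longlonglongrightarrow> x \<and>
        (\<forall>e>0. \<exists>N. \<forall>m\<ge>N. \<forall>n\<ge>N. cmod (a (u m - u n) (u m - u n)) < e) \<longrightarrow>
        x \<in> D \<and> (\<lambda>n. a (u n - x) (u n - x)) \<longlonglongrightarrow> 0)"

text \<open>
  The operator of the first representation theorem: \<open>x \<in> D\<close> belongs to its domain, with value
  \<open>z\<close>, iff \<open>a y x = \<langle>y, z\<rangle>\<close> for all \<open>y \<in> D\<close>; \<open>z\<close> is unique when \<open>D\<close> is dense.
\<close>

definition associated_op ::
    "'a::complex_inner set \<Rightarrow> ('a \<Rightarrow> 'a \<Rightarrow> complex) \<Rightarrow> 'a partial_op" where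
  "associated_op D a x =
     (if x \<in> D \<and> (\<exists>z. \<forall>y\<in>D. a y x = cinner y z)
      then Some (THE z. \<forall>y\<in>D. a y x = cinner y z)
      else None)"

end

theory Submission
  imports Defs
begin

text \<open>
  Minimising \<open>a[x,x] - 2 Re \<phi>(x)\<close> gives the Riesz representation theorem for closed positive definite
  forms, and hence a bounded positive injective operator \<open>R = A\<^sup>-\<^sup>1\<close>. If \<open>Q\<close> is the bounded positive
  square root of \<open>R\<close>, then \<open>Q\<^sup>-\<^sup>1\<close>, with domain \<open>range Q\<close>, is the only nonnegative self-adjoint square root
  of \<open>A\<close>: the inverse of any other one is an everywhere defined symmetric, hence bounded, root of \<open>R\<close>.
  Approximating by vectors in \<open>range R\<close> shows \<open>range Q \<subseteq> D\<close> and \<open>a[Q u, Q v] = \<langle>u, v\<rangle>\<close>, while Riesz for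
  \<open>f \<mapsto> a[x, Q f]\<close> shows that every \<open>x \<in> D\<close> lies in \<open>range Q\<close>. Finally \<open>H\<close> represents the bounded coercive
  form \<open>b[Q u, Q v]\<close> on the whole space.
\<close>

subsection \<open>Nonnegative and closed forms\<close>

lemma scaleC_one [simp]: "1 *\<^sub>C (x::'a::complex_inner) = x"
  using scaleR_scaleC[of 1 x] by simp

lemma scaleC_minus1: "(- 1) *\<^sub>C (x::'a::complex_inner) = - x"
  using scaleR_scaleC[of "- 1" x] by simp

lemma csubspaceD:
  assumes "csubspace D"
  shows csubspace_0: "0 \<in> D"
    and csubspace_add: "\<And>x y. x \<in> D \<Longrightarrow> y \<in> D \<Longrightarrow> x + y \<in> D"
    and csubspace_scaleC: "\<And>c x. x \<in> D \<Longrightarrow> c *\<^sub>C x \<in> D"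
    and csubspace_diff: "\<And>x y. x \<in> D \<Longrightarrow> y \<in> D \<Longrightarrow> x - y \<in> D"
proof -
  show "0 \<in> D" and add: "\<And>x y. x \<in> D \<Longrightarrow> y \<in> D \<Longrightarrow> x + y \<in> D"
    and scale: "\<And>c x. x \<in> D \<Longrightarrow> c *\<^sub>C x \<in> D"
    using assms by (auto simp: csubspace_def)
  show "x - y \<in> D" if "x \<in> D" "y \<in> D" for x y
    using add[OF that(1) scale[OF that(2), of "- 1"]] by (simp add: scaleC_minus1)
qed

text \<open>Only nonnegativity is asked, so that Cauchy-Schwarz holds both for the given form and
  for the possibly degenerate forms \<open>cinner x (T y)\<close> of nonnegative operators.\<close>

locale nonneg_form =
  fixes D :: "'a::complex_inner set" and a :: "'a \<Rightarrow> 'a \<Rightarrow> complex"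
  assumes sesquilinear: "sesquilinear_form D a"
    and symmetric: "symmetric_form D a"
    and nonneg: "x \<in> D \<Longrightarrow> 0 \<le> Re (a x x)"
begin

lemma subspace: "csubspace D"
  using sesquilinear by (simp add: sesquilinear_form_def)

lemmas mem = csubspaceD[OF subspace]

lemma add_right: "x \<in> D \<Longrightarrow> y \<in> D \<Longrightarrow> z \<in> D \<Longrightarrow> a x (y + z) = a x y + a x z"
  and add_left: "x \<in> D \<Longrightarrow> y \<in> D \<Longrightarrow> z \<in> D \<Longrightarrow> a (x + y) z = a x z + a y z"
  and scaleC_right: "x \<in> D \<Longrightarrow> y \<in> D \<Longrightarrow> a x (c *\<^sub>C y) = c * a x y"
  and scaleC_left: "x \<in> D \<Longrightarrow> y \<in> D \<Longrightarrow> a (c *\<^sub>C x) y = cnj c * a x y"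
  using sesquilinear by (auto simp: sesquilinear_form_def)

lemma commute: "x \<in> D \<Longrightarrow> y \<in> D \<Longrightarrow> a x y = cnj (a y x)"
  using symmetric unfolding symmetric_form_def by blast

lemma diff_right: "x \<in> D \<Longrightarrow> y \<in> D \<Longrightarrow> z \<in> D \<Longrightarrow> a x (y - z) = a x y - a x z"
  using add_right[of x y "(- 1) *\<^sub>C z"] scaleC_right[of x z "- 1"] mem(3)[of z "- 1"]
  by (simp add: scaleC_minus1)

lemma diff_left: "x \<in> D \<Longrightarrow> y \<in> D \<Longrightarrow> z \<in> D \<Longrightarrow> a (x - y) z = a x z - a y z"
  using add_left[of x "(- 1) *\<^sub>C y" z] scaleC_left[of y z "- 1"] mem(3)[of y "- 1"]
  by (simp add: scaleC_minus1)

lemma self_real: "x \<in> D \<Longrightarrow> a x x = complex_of_real (Re (a x x))"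
  using commute[of x x] by (metis Im_complex_of_real Re_complex_of_real cnj.simps(2) complex_eq_iff
    equal_neg_zero)

lemma cmod_self: "x \<in> D \<Longrightarrow> cmod (a x x) = Re (a x x)"
  using self_real[of x] nonneg[of x] by (metis abs_of_nonneg norm_of_real)

lemma expand:
  assumes "x \<in> D" "y \<in> D"
  shows "Re (a (x + c *\<^sub>C y) (x + c *\<^sub>C y)) =
    Re (a x x) + 2 * Re (c * a x y) + (cmod c)\<^sup>2 * Re (a y y)"
proof -
  have "a (x + c *\<^sub>C y) (x + c *\<^sub>C y)
      = a x x + c * a x y + cnj (c * a x y) + (c * cnj c) * a y y"
    using assms commute[OF assms(2,1)]
    by (simp add: add_left add_right scaleC_left scaleC_right mem algebra_simps)
  then show ?thesis
    using self_real[OF assms(2)]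
    by (simp add: complex_norm_square[symmetric] cmod_power2 power2_eq_square algebra_simps)
qed

lemma Cauchy_Schwarz:
  assumes "x \<in> D" "y \<in> D"
  shows "cmod (a x y) \<le> sqrt (Re (a x x)) * sqrt (Re (a y y))"
proof -
  define N where "N = (cmod (a x y))\<^sup>2"
  have N0: "0 \<le> N" by (simp add: N_def)
  have quad: "0 \<le> Re (a x x) - 2 * r * N + r\<^sup>2 * N * Re (a y y)" for r
  proof -
    \<comment> \<open>This phase makes the cross term real, so that expanding a[x + c y, x + c y]
      leaves a real quadratic polynomial in \<open>r\<close>.\<close>
    define c where "c = - complex_of_real r * cnj (a x y)"
    have "Re (c * a x y) = - r * N"
      unfolding c_def N_def cmod_power2 by (simp add: power2_eq_square algebra_simps)
    moreover have "(cmod c)\<^sup>2 = r\<^sup>2 * N"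
      by (simp add: c_def N_def norm_mult power_mult_distrib)
    moreover have "0 \<le> Re (a (x + c *\<^sub>C y) (x + c *\<^sub>C y))"
      using assms by (intro nonneg mem)
    ultimately show ?thesis
      using expand[OF assms, of c] by simp
  qed
  have "N \<le> Re (a x x) * Re (a y y)"
  proof (cases "Re (a y y) = 0")
    case True
    have "N = 0"
    proof (rule ccontr)
      assume "N \<noteq> 0"
      \<comment> \<open>With a[y,y] = 0 the polynomial is affine in \<open>r\<close>, and at this
        \<open>r\<close> its value is -1.\<close>
      then show False
        using quad[of "(Re (a x x) + 1) / (2 * N)"] True by simp
    qed
    then show ?thesis using True by simp
  next
    case False
    then have pos: "0 < Re (a y y)" using nonneg[OF assms(2)] by simp
    \<comment> \<open>The minimum of the polynomial, at r = 1 / a[y,y].\<close>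
    have "0 \<le> Re (a x x) - N / Re (a y y)"
      using quad[of "1 / Re (a y y)"] pos by (simp add: power2_eq_square)
    then show ?thesis using pos by (simp add: field_simps)
  qed
  then have "sqrt N \<le> sqrt (Re (a x x) * Re (a y y))" by simp
  then show ?thesis by (simp add: N_def real_sqrt_mult)
qed

end

section \<open>Closed positive definite forms: completeness and Riesz representation\<close>

locale closed_positive_form = nonneg_form D a
  for D :: "'a::chilbert_space set" and a :: "'a \<Rightarrow> 'a \<Rightarrow> complex" +
  assumes positive_definite: "positive_definite_form D a"
    and closed_form: "closed_form D a"
begin

lemma bounded_below:
  obtains c where "0 < c" "\<And>x. x \<in> D \<Longrightarrow> c * (norm x)\<^sup>2 \<le> Re (a x x)"
  using positive_definite unfolding positive_definite_form_def by metis

text \<open>Positive definiteness turns a Cauchy sequence for the form into one for the norm, and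
  closedness turns its norm limit into a form limit. The norm convergence is recorded so that the
  limit can be identified elsewhere.\<close>

lemma complete:
  fixes u :: "nat \<Rightarrow> 'a"
  assumes u: "\<And>n. u n \<in> D"
    and cauchy: "\<And>e. 0 < e \<Longrightarrow> \<exists>N. \<forall>m\<ge>N. \<forall>n\<ge>N. Re (a (u m - u n) (u m - u n)) < e"
  obtains x where "x \<in> D" "(\<lambda>n. Re (a (u n - x) (u n - x))) \<longlonglongrightarrow> 0" "u \<longlonglongrightarrow> x"
proof -
  obtain c where c: "0 < c" "\<And>x. x \<in> D \<Longrightarrow> c * (norm x)\<^sup>2 \<le> Re (a x x)"
    using bounded_below by blast
  have "Cauchy u"
  proof (rule metric_CauchyI)
    fix e :: real assume e: "0 < e"
    then obtain N where N: "\<And>m n. m \<ge> N \<Longrightarrow> n \<ge> N \<Longrightarrow> Re (a (u m - u n) (u m - u n)) < c * e\<^sup>2"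
      using cauchy[of "c * e\<^sup>2"] c(1) by auto
    have "dist (u m) (u n) < e" if "m \<ge> N" "n \<ge> N" for m n
    proof -
      have "c * (norm (u m - u n))\<^sup>2 < c * e\<^sup>2"
        using N[OF that] c(2)[OF mem(4)[OF u u], of m n] by linarith
      then have "(norm (u m - u n))\<^sup>2 < e\<^sup>2" using c(1) by simp
      then show ?thesis using e by (simp add: dist_norm power2_less_imp_less)
    qed
    then show "\<exists>N. \<forall>m\<ge>N. \<forall>n\<ge>N. dist (u m) (u n) < e" by blast
  qed
  then obtain x where x: "u \<longlonglongrightarrow> x"
    using Cauchy_convergent_iff convergent_def by blast
  have "\<forall>e>0. \<exists>N. \<forall>m\<ge>N. \<forall>n\<ge>N. cmod (a (u m - u n) (u m - u n)) < e"
    using cauchy u by (simp add: cmod_self mem)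
  then have xD: "x \<in> D" and lim: "(\<lambda>n. a (u n - x) (u n - x)) \<longlonglongrightarrow> 0"
    using closed_form[unfolded closed_form_def, THEN spec[of _ u], THEN spec[of _ x]] x u
    by blast+
  show thesis
    using that[OF xD _ x] tendsto_Re[OF lim] by simp
qed

lemma tendsto_form:
  assumes "\<And>n. u n \<in> D" "\<And>n. v n \<in> D" "x \<in> D" "y \<in> D"
    and u: "(\<lambda>n. Re (a (u n - x) (u n - x))) \<longlonglongrightarrow> 0"
    and v: "(\<lambda>n. Re (a (v n - y) (v n - y))) \<longlonglongrightarrow> 0"
  shows "(\<lambda>n. a (u n) (v n)) \<longlonglongrightarrow> a x y"
proof -
  let ?N = "\<lambda>z. sqrt (Re (a z z))"
  have "(\<lambda>n. ?N (u n - x) * ?N y + ?N x * ?N (v n - y) + ?N (u n - x) * ?N (v n - y))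
      \<longlonglongrightarrow> sqrt 0 * ?N y + ?N x * sqrt 0 + sqrt 0 * sqrt 0"
    by (intro tendsto_intros u v)
  then have lim: "(\<lambda>n. ?N (u n - x) * ?N y + ?N x * ?N (v n - y) + ?N (u n - x) * ?N (v n - y))
      \<longlonglongrightarrow> 0" by simp
  have "cmod (a (u n) (v n) - a x y)
      \<le> ?N (u n - x) * ?N y + ?N x * ?N (v n - y) + ?N (u n - x) * ?N (v n - y)" for n
  proof -
    have "a (u n) (v n) - a x y = a (u n - x) y + a x (v n - y) + a (u n - x) (v n - y)"
      using assms(1-4) by (simp add: diff_left diff_right mem)
    also have "cmod \<dots> \<le> cmod (a (u n - x) y) + cmod (a x (v n - y)) + cmod (a (u n - x) (v n - y))"
      by (meson norm_triangle_ineq order_trans add_right_mono)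
    also have "\<dots> \<le> ?N (u n - x) * ?N y + ?N x * ?N (v n - y) + ?N (u n - x) * ?N (v n - y)"
      using assms(1-4) by (intro add_mono Cauchy_Schwarz mem)
    finally show ?thesis .
  qed
  then have "\<forall>n. cmod (a (u n) (v n) - a x y)
      \<le> ?N (u n - x) * ?N y + ?N x * ?N (v n - y) + ?N (u n - x) * ?N (v n - y)" ..
  from Lim_null_comparison[OF always_eventually[OF this] lim] show ?thesis
    by (rule LIM_zero_cancel)
qed

text \<open>By the parallelogram law a minimising sequence is Cauchy in the form norm.\<close>

lemma Riesz_representation:
  assumes add: "\<And>x y. x \<in> D \<Longrightarrow> y \<in> D \<Longrightarrow> \<phi> (x + y) = \<phi> x + \<phi> y"
    and scale: "\<And>c x. x \<in> D \<Longrightarrow> \<phi> (c *\<^sub>C x) = c * \<phi> x"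
    and bound: "\<And>x. x \<in> D \<Longrightarrow> cmod (\<phi> x) \<le> K * sqrt (Re (a x x))"
  obtains z where "z \<in> D" "\<And>x. x \<in> D \<Longrightarrow> \<phi> x = a z x"
proof -
  define J where "J x = Re (a x x) - 2 * Re (\<phi> x)" for x
  \<comment> \<open>Completing the square: with s the form norm of x, J(x) is at least s^2 - 2 K s,
    which is at least -K^2.\<close>
  have J_ge: "- K\<^sup>2 \<le> J x" if "x \<in> D" for x
  proof -
    let ?s = "sqrt (Re (a x x))"
    have "Re (\<phi> x) \<le> K * ?s"
      using bound[OF that] complex_Re_le_cmod order_trans by blast
    moreover have "Re (a x x) = ?s\<^sup>2" using nonneg[OF that] by simp
    moreover have "0 \<le> (?s - K)\<^sup>2" by simp
    ultimately show ?thesis by (simp add: J_def power2_eq_square algebra_simps)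
  qed
  define m where "m = (INF x\<in>D. J x)"
  have bdd: "bdd_below (J ` D)" using J_ge by (rule bdd_belowI2)
  have m_le: "m \<le> J x" if "x \<in> D" for x
    unfolding m_def by (rule cINF_lower[OF bdd that])
  have "\<exists>x\<in>D. J x < m + e" if "0 < e" for e
  proof -
    have "D \<noteq> {}" using mem(1) by blast
    moreover have "(INF x\<in>D. J x) < m + e" using that by (simp only: m_def)
    ultimately show ?thesis using cINF_less_iff[OF _ bdd] by blast
  qed
  then have "\<forall>n. \<exists>x. x \<in> D \<and> J x < m + inverse (real (Suc n))"
    by (simp add: Bex_def)
  then obtain u where u: "\<And>n. u n \<in> D" and Ju: "\<And>n. J (u n) < m + inverse (real (Suc n))"
    by metis
  \<comment> \<open>The exact second-order expansion of \<open>J\<close>; the first-order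
    coefficient is the defect that has to vanish at the minimiser.\<close>
  have shift: "J (x + c *\<^sub>C y) = J x + 2 * Re (c * (a x y - \<phi> y)) + (cmod c)\<^sup>2 * Re (a y y)"
    if "x \<in> D" "y \<in> D" for x y c
    using that by (simp add: J_def expand add scale mem algebra_simps)
  \<comment> \<open>\<open>J\<close> is expanded around \<open>y\<close> at \<open>x\<close> and at
    the midpoint of \<open>x\<close> and \<open>y\<close>. Since \<open>J\<close> is at least
    \<open>m\<close> at the midpoint, the first-order term can be eliminated.\<close>
  have mid: "Re (a (x - y) (x - y)) \<le> 2 * (J x + J y - 2 * m)" if xy: "x \<in> D" "y \<in> D" for x y
  proof -
    have d: "x - y \<in> D" using xy by (rule mem)
    have "J x = J y + 2 * Re (a y (x - y) - \<phi> (x - y)) + Re (a (x - y) (x - y))"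
      using shift[OF xy(2) d, of 1] by simp
    moreover have "J (y + (1/2) *\<^sub>C (x - y))
        = J y + Re (a y (x - y) - \<phi> (x - y)) + Re (a (x - y) (x - y)) / 4"
      using shift[OF xy(2) d, of "1/2"] by (simp add: power2_eq_square norm_divide)
    moreover have "m \<le> J (y + (1/2) *\<^sub>C (x - y))"
      using xy d by (intro m_le mem)
    ultimately show ?thesis by simp
  qed
  have cauchy: "\<exists>N. \<forall>m\<ge>N. \<forall>n\<ge>N. Re (a (u m - u n) (u m - u n)) < e" if "0 < e" for e
  proof -
    \<comment> \<open>By \<open>mid\<close> the squared form distance is below 2 (1/(i+1) +
      1/(j+1)), hence below 4/(N+1).\<close>
    have "0 < e / 4" using that by simp
    then obtain N where N: "inverse (real (Suc N)) < e / 4"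
      using reals_Archimedean by blast
    have "Re (a (u i - u j) (u i - u j)) < e" if "i \<ge> N" "j \<ge> N" for i j
    proof -
      have "inverse (real (Suc i)) \<le> inverse (real (Suc N))"
        "inverse (real (Suc j)) \<le> inverse (real (Suc N))"
        using that by (auto intro!: le_imp_inverse_le)
      then show ?thesis
        using mid[OF u[of i] u[of j]] Ju[of i] Ju[of j] N by argo
    qed
    then show ?thesis by blast
  qed
  obtain z where z: "z \<in> D" and uz: "(\<lambda>n. Re (a (u n - z) (u n - z))) \<longlonglongrightarrow> 0"
    by (rule complete[OF u cauchy])
  have Re_eq: "Re (a z y) = Re (\<phi> y)" if y: "y \<in> D" for y
  proof -
    \<comment> \<open>The first variation is computed at \<open>u n\<close>, where \<open>J\<close>
      exceeds its infimum by less than 1/(n+1), and then passed to the limit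
      \<open>z\<close>.\<close>
    have quad: "0 \<le> 2 * (t * (Re (a z y) - Re (\<phi> y))) + t\<^sup>2 * Re (a y y)" for t :: real
    proof -
      have const: "(\<lambda>n. Re (a (y - y) (y - y))) \<longlonglongrightarrow> 0"
        using diff_left[OF y y mem(1)] by simp
      have *: "0 \<le> 2 * (t * (Re (a (u n) y) - Re (\<phi> y))) + t\<^sup>2 * Re (a y y) + inverse (real (Suc n))"
        for n
      proof -
        have "m \<le> J (u n + complex_of_real t *\<^sub>C y)"
          using u y by (intro m_le mem)
        then show ?thesis
          using shift[OF u y, of n "complex_of_real t"] Ju[of n] by simp
      qed
      have "(\<lambda>n. 2 * (t * (Re (a (u n) y) - Re (\<phi> y))) + t\<^sup>2 * Re (a y y) + inverse (real (Suc n)))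
          \<longlonglongrightarrow> 2 * (t * (Re (a z y) - Re (\<phi> y))) + t\<^sup>2 * Re (a y y) + 0"
        by (intro tendsto_intros LIMSEQ_inverse_real_of_nat tendsto_form u y z uz const)
      then have "0 \<le> 2 * (t * (Re (a z y) - Re (\<phi> y))) + t\<^sup>2 * Re (a y y) + 0"
        by (rule LIMSEQ_le_const) (use * in blast)
      then show ?thesis by simp
    qed
    define d where "d = Re (a z y) - Re (\<phi> y)"
    \<comment> \<open>The added 1 keeps \<open>q\<close> positive even if a[y,y] = 0. The choice t =
      -d/q makes the inequality force d = 0.\<close>
    define q where "q = Re (a y y) + 1"
    have q: "0 < q" using nonneg[OF y] by (simp add: q_def)
    have "0 \<le> 2 * ((- d / q) * d) + (- d / q)\<^sup>2 * (q - 1)"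
      using quad[of "- d / q"] unfolding d_def q_def by simp
    also have "\<dots> = - (d\<^sup>2 / q) - d\<^sup>2 / q\<^sup>2"
      using q by (simp add: field_simps power2_eq_square)
    finally have "d\<^sup>2 / q + d\<^sup>2 / q\<^sup>2 \<le> 0" by simp
    moreover have "0 \<le> d\<^sup>2 / q" "0 \<le> d\<^sup>2 / q\<^sup>2" using q by simp_all
    ultimately have "d\<^sup>2 / q = 0" by linarith
    then show ?thesis using q by (simp add: d_def)
  qed
  \<comment> \<open>The real parts at \<i> y supply the imaginary parts at y.\<close>
  have "\<phi> y = a z y" if y: "y \<in> D" for y
    using Re_eq[OF y] Re_eq[OF mem(3)[OF y, of \<i>]] y z
    by (simp add: scale scaleC_right complex_eq_iff)
  then show thesis using that z by blast
qed

end

lemma closed_positive_formI: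
  fixes D :: "'a::chilbert_space set"
  assumes "sesquilinear_form D a" "symmetric_form D a" "positive_definite_form D a" "closed_form D a"
  shows "closed_positive_form D a"
proof
  fix x assume "x \<in> D"
  then show "0 \<le> Re (a x x)"
    using assms(3) unfolding positive_definite_form_def
    by (metis less_imp_le mult_nonneg_nonneg order_trans zero_le_power2)
qed (fact assms)+

subsection \<open>Symmetric operators on Hilbert spaces\<close>

lemma norm_scaleC: "norm (c *\<^sub>C x) = cmod c * norm (x::'a::complex_inner)"
proof -
  have "cinner (c *\<^sub>C x) (c *\<^sub>C x) = (c * cnj c) * cinner x x"
    using cinner_commute[of "c *\<^sub>C x" x] cinner_commute[of x x]
    by (simp add: cinner_scaleC_right)
  then have "complex_of_real ((norm (c *\<^sub>C x))\<^sup>2) = complex_of_real ((cmod c * norm x)\<^sup>2)"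
    by (simp add: cinner_self complex_norm_square[symmetric] power_mult_distrib)
  then have "(norm (c *\<^sub>C x))\<^sup>2 = (cmod c * norm x)\<^sup>2"
    using of_real_eq_iff by blast
  then show ?thesis by (simp add: power2_eq_iff_nonneg)
qed

lemma bounded_linear_scaleC: "bounded_linear ((*\<^sub>C) c :: 'a::complex_inner \<Rightarrow> 'a)"
proof (rule bounded_linear_intro)
  show "c *\<^sub>C (x + y) = c *\<^sub>C x + c *\<^sub>C y" for x y :: 'a
    by (rule scaleC_add_right)
  show "c *\<^sub>C r *\<^sub>R x = r *\<^sub>R c *\<^sub>C x" for r and x :: 'a
    by (simp add: scaleR_scaleC scaleC_scaleC mult.commute)
  show "norm (c *\<^sub>C x) \<le> norm x * cmod c" for x :: 'a
    by (simp add: norm_scaleC mult.commute)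
qed

lemma csubspace_UNIV: "csubspace UNIV"
  by (simp add: csubspace_def)

lemma csubspace_closure:
  assumes "csubspace M"
  shows "csubspace (closure M)"
  unfolding csubspace_def
proof (intro conjI ballI allI)
  show "0 \<in> closure M"
    using csubspace_0[OF assms] closure_subset by blast
next
  fix x y assume "x \<in> closure M" "y \<in> closure M"
  then obtain u v where uv: "\<And>n. u n \<in> M" "u \<longlonglongrightarrow> x" "\<And>n. v n \<in> M" "v \<longlonglongrightarrow> y"
    by (auto simp: closure_sequential)
  have "(\<lambda>n. u n + v n) \<longlonglongrightarrow> x + y" by (intro tendsto_add uv)
  moreover have "u n + v n \<in> M" for n by (intro csubspace_add[OF assms] uv)
  ultimately show "x + y \<in> closure M"
    unfolding closure_sequential by (intro exI[of _ "\<lambda>n. u n + v n"]) simp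
next
  fix c x assume "x \<in> closure M"
  then obtain u where u: "\<And>n. u n \<in> M" "u \<longlonglongrightarrow> x"
    by (auto simp: closure_sequential)
  have "(\<lambda>n. c *\<^sub>C u n) \<longlonglongrightarrow> c *\<^sub>C x"
    by (rule bounded_linear.tendsto[OF bounded_linear_scaleC u(2)])
  moreover have "c *\<^sub>C u n \<in> M" for n by (intro csubspace_scaleC[OF assms] u)
  ultimately show "c *\<^sub>C x \<in> closure M"
    unfolding closure_sequential by (intro exI[of _ "\<lambda>n. c *\<^sub>C u n"]) simp
qed

text \<open>This makes the results on forms, above all Riesz representation, available for closed
  subspaces and for the whole Hilbert space.\<close>

lemma closed_positive_form_cinner:
  fixes M :: "'a::chilbert_space set"
  assumes "csubspace M" "closed M"
  shows "closed_positive_form M cinner"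
proof (rule closed_positive_formI)
  have add_left: "cinner (x + y) z = cinner x z + cinner y z" for x y z :: 'a
  proof -
    have "cinner (x + y) z = cnj (cinner z (x + y))" by (rule cinner_commute)
    also have "\<dots> = cnj (cinner z x) + cnj (cinner z y)" by (simp add: cinner_add_right)
    also have "\<dots> = cinner x z + cinner y z" by (simp only: cinner_commute[symmetric])
    finally show ?thesis .
  qed
  have scale_left: "cinner (c *\<^sub>C x) y = cnj c * cinner x y" for c and x y :: 'a
  proof -
    have "cinner (c *\<^sub>C x) y = cnj (cinner y (c *\<^sub>C x))" by (rule cinner_commute)
    also have "\<dots> = cnj c * cnj (cinner y x)" by (simp add: cinner_scaleC_right)
    also have "\<dots> = cnj c * cinner x y" by (simp only: cinner_commute[symmetric])
    finally show ?thesis .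
  qed
  show "sesquilinear_form M cinner"
    using assms(1) by (simp add: sesquilinear_form_def cinner_add_right cinner_scaleC_right
      add_left scale_left)
  show "symmetric_form M cinner"
    unfolding symmetric_form_def using cinner_commute by blast
  show "positive_definite_form M cinner"
    unfolding positive_definite_form_def by (intro exI[of _ 1]) (simp add: cinner_self)
  show "closed_form M cinner"
    unfolding closed_form_def
  proof (intro allI impI, elim conjE, intro conjI)
    fix u x assume u: "\<forall>n::nat. u n \<in> M" "u \<longlonglongrightarrow> x"
    show "x \<in> M" using assms(2) u closed_sequentially by blast
    have "(\<lambda>n. complex_of_real ((norm (u n - x))\<^sup>2)) \<longlonglongrightarrow> complex_of_real ((norm (x - x))\<^sup>2)"
      by (intro tendsto_intros u)
    then show "(\<lambda>n. cinner (u n - x) (u n - x)) \<longlonglongrightarrow> 0"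
      by (simp add: cinner_self)
  qed
qed

section \<open>The inner product of the whole space: separation, continuity and density\<close>

interpretation cinner: closed_positive_form "UNIV :: 'a::chilbert_space set" cinner
  by (intro closed_positive_form_cinner csubspace_UNIV closed_UNIV)

lemmas cinner_simps =
  cinner.add_left[OF UNIV_I UNIV_I UNIV_I] cinner.add_right[OF UNIV_I UNIV_I UNIV_I]
  cinner.diff_left[OF UNIV_I UNIV_I UNIV_I] cinner.diff_right[OF UNIV_I UNIV_I UNIV_I]
  cinner.scaleC_left[OF UNIV_I UNIV_I] cinner.scaleC_right[OF UNIV_I UNIV_I]

lemma cinner_zero_right [simp]: "cinner x (0::'a::chilbert_space) = 0"
  using cinner_simps(4)[of x 0 0] by simp

lemma cinner_zero_left [simp]: "cinner (0::'a::chilbert_space) x = 0"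
  using cinner_simps(3)[of 0 0 x] by simp

lemma norm_cinner_le: "cmod (cinner x y) \<le> norm x * norm (y::'a::chilbert_space)"
  using cinner.Cauchy_Schwarz[of x y] by (simp add: cinner_self)

lemma cinner_eq_zeroD: "cinner x x = 0 \<Longrightarrow> x = (0::'a::chilbert_space)"
  by (simp add: cinner_self)

lemma cinner_eqI_right:
  assumes "\<And>x. cinner x y = cinner x (z::'a::chilbert_space)"
  shows "y = z"
  using cinner_eq_zeroD[of "y - z"] assms by (simp add: cinner_simps)

lemma cinner_eqI_left:
  assumes "\<And>x. cinner y x = cinner (z::'a::chilbert_space) x"
  shows "y = z"
  using cinner_eq_zeroD[of "y - z"] assms by (simp add: cinner_simps)

lemma tendsto_cinner:
  fixes x y :: "'a::chilbert_space"
  assumes "u \<longlonglongrightarrow> x" "v \<longlonglongrightarrow> y"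
  shows "(\<lambda>n. cinner (u n) (v n)) \<longlonglongrightarrow> cinner x y"
proof -
  have "(\<lambda>n. Re (cinner (w n - z) (w n - z))) \<longlonglongrightarrow> 0" if "w \<longlonglongrightarrow> z" for w and z :: 'a
  proof -
    have "(\<lambda>n. (norm (w n - z))\<^sup>2) \<longlonglongrightarrow> (norm (z - z))\<^sup>2"
      by (intro tendsto_intros that)
    then show ?thesis by (simp add: cinner_self)
  qed
  from this[OF assms(1)] this[OF assms(2)] show ?thesis
    using cinner.tendsto_form[of u v x y] by simp
qed

lemma cinner_eqI_dense:
  assumes "closure M = UNIV" "\<And>x. x \<in> M \<Longrightarrow> cinner y x = cinner (z::'a::chilbert_space) x"
  shows "y = z"
proof (rule cinner_eqI_left)
  fix x
  have "x \<in> closure M" using assms(1) by simp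
  then obtain u where u: "\<And>n. u n \<in> M" "u \<longlonglongrightarrow> x"
    unfolding closure_sequential by blast
  have "(\<lambda>n. cinner y (u n)) \<longlonglongrightarrow> cinner y x" "(\<lambda>n. cinner z (u n)) \<longlonglongrightarrow> cinner z x"
    by (intro tendsto_cinner tendsto_const u)+
  then show "cinner y x = cinner z x"
    by (simp add: assms(2) u(1) LIMSEQ_unique)
qed

text \<open>Riesz representation on the closure of \<open>M\<close>, applied to the functional of
  \<open>x\<close>, yields the orthogonal projection \<open>z\<close> of \<open>x\<close>. Then x -
  z is orthogonal to \<open>M\<close>, hence zero.\<close>

lemma dense_csubspaceI:
  fixes M :: "'a::chilbert_space set"
  assumes M: "csubspace M" and orth: "\<And>x. (\<And>y. y \<in> M \<Longrightarrow> cinner x y = 0) \<Longrightarrow> x = 0"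
  shows "closure M = UNIV"
proof -
  interpret M: closed_positive_form "closure M" cinner
    by (intro closed_positive_form_cinner csubspace_closure M closed_closure)
  have "x \<in> closure M" for x
  proof -
    obtain z where z: "z \<in> closure M" "\<And>y. y \<in> closure M \<Longrightarrow> cinner x y = cinner z y"
    proof (rule M.Riesz_representation[of "cinner x" "norm x"])
      show "cmod (cinner x y) \<le> norm x * sqrt (Re (cinner y y))" for y
        using norm_cinner_le[of x y] by (simp add: cinner_self)
    qed (auto simp: cinner_simps)
    have "x - z = 0"
      using z(2) closure_subset by - (rule orth, auto simp: cinner_simps)
    then show ?thesis using z(1) by simp
  qed
  then show ?thesis by blast
qed

section \<open>Everywhere defined symmetric operators\<close>

definition symmetric_op :: "('a::chilbert_space \<Rightarrow> 'a) \<Rightarrow> bool" where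
  "symmetric_op T \<longleftrightarrow> (\<forall>x y. cinner (T x) y = cinner x (T y))"

lemma symmetric_opD: "symmetric_op T \<Longrightarrow> cinner (T x) y = cinner x (T y)"
  by (simp add: symmetric_op_def)

text \<open>Linearity is a consequence of symmetry: move \<open>T\<close> to the other argument,
  where the inner product is linear in the remaining one, and move it back.\<close>

lemma symmetric_op_add: "symmetric_op T \<Longrightarrow> T (x + y) = T x + T y"
  by (rule cinner_eqI_left) (simp add: symmetric_opD cinner_simps)

lemma symmetric_op_scaleC: "symmetric_op T \<Longrightarrow> T (c *\<^sub>C x) = c *\<^sub>C T x"
  by (rule cinner_eqI_left) (simp add: symmetric_opD cinner_simps)

lemma symmetric_op_diff: "symmetric_op T \<Longrightarrow> T (x - y) = T x - T y"
  by (rule cinner_eqI_left) (simp add: symmetric_opD cinner_simps)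

lemma symmetric_op_zero: "symmetric_op T \<Longrightarrow> T 0 = 0"
  using symmetric_op_diff[of T 0 0] by simp

lemma symmetric_op_bounded_clinear:
  assumes "symmetric_op T" "\<And>x. norm (T x) \<le> K * norm x"
  shows "bounded_clinear T"
  unfolding bounded_clinear_def
proof (intro conjI allI)
  show "bounded_linear T"
    using assms by (intro bounded_linear_intro[where K = K])
      (simp_all add: symmetric_op_add symmetric_op_scaleC scaleR_scaleC mult.commute)
qed (simp add: symmetric_op_scaleC assms)

lemma csubspace_range:
  assumes "symmetric_op T"
  shows "csubspace (range T)"
  unfolding csubspace_def
proof (intro conjI ballI allI)
  show "0 \<in> range T" by (rule range_eqI[of _ T 0]) (simp add: symmetric_op_zero[OF assms])
next
  fix x y assume "x \<in> range T" "y \<in> range T"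
  then obtain u v where "x = T u" "y = T v" by blast
  then show "x + y \<in> range T"
    by (intro range_eqI[of _ T "u + v"]) (simp add: symmetric_op_add[OF assms])
next
  fix c x assume "x \<in> range T"
  then obtain u where "x = T u" by blast
  then show "c *\<^sub>C x \<in> range T"
    by (intro range_eqI[of _ T "c *\<^sub>C u"]) (simp add: symmetric_op_scaleC[OF assms])
qed

text \<open>A vector orthogonal to the range of a symmetric operator lies in its kernel.\<close>

lemma dense_range:
  assumes "symmetric_op T" "\<And>x. T x = 0 \<Longrightarrow> x = 0"
  shows "closure (range T) = UNIV"
proof (rule dense_csubspaceI[OF csubspace_range[OF assms(1)]])
  fix x assume "\<And>y. y \<in> range T \<Longrightarrow> cinner x y = 0"
  then have "T x = 0"
    by - (rule cinner_eqI_left, simp add: symmetric_opD[OF assms(1)])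
  then show "x = 0" by (rule assms(2))
qed

lemma nonneg_form_op:
  assumes "symmetric_op T" "\<And>x. 0 \<le> Re (cinner x (T x))"
  shows "nonneg_form UNIV (\<lambda>x y. cinner x (T y))"
proof
  show "sesquilinear_form UNIV (\<lambda>x y. cinner x (T y))"
    by (simp add: sesquilinear_form_def csubspace_UNIV cinner_simps
      symmetric_op_add[OF assms(1)] symmetric_op_scaleC[OF assms(1)])
  show "symmetric_form UNIV (\<lambda>x y. cinner x (T y))"
    unfolding symmetric_form_def using cinner_commute symmetric_opD[OF assms(1)] by metis
qed (rule assms(2))

text \<open>Cauchy-Schwarz for the form <x, T y>, applied to the pair \<open>T x\<close>,
  \<open>x\<close>, bounds |T x|^2 by a multiple of the root of <x, T x>.\<close>

lemma nonneg_op_eq_zero: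
  assumes "symmetric_op T" "\<And>x. 0 \<le> Re (cinner x (T x))" "Re (cinner x (T x)) = 0"
  shows "T x = 0"
proof -
  interpret nonneg_form UNIV "\<lambda>x y. cinner x (T y)"
    by (rule nonneg_form_op[OF assms(1,2)])
  have "cmod (cinner (T x) (T x)) \<le> 0"
    using Cauchy_Schwarz[of "T x" x] assms(3) by simp
  then show ?thesis using cinner_eq_zeroD[of "T x"] by simp
qed

text \<open>Commuting roots satisfy (Q + T)(Q - T) = 0. At y = Q x - T x the two nonnegative
  quadratic forms add up to zero, so both vanish; then Q y = 0 and y = 0 by injectivity.\<close>

lemma nonneg_sqrt_unique:
  assumes Q: "symmetric_op Q" "\<And>x. 0 \<le> Re (cinner x (Q x))"
    and T: "symmetric_op T" "\<And>x. 0 \<le> Re (cinner x (T x))"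
    and eq: "\<And>x. T (T x) = Q (Q x)" and comm: "\<And>x. T (Q x) = Q (T x)"
    and inj: "\<And>x. Q x = 0 \<Longrightarrow> x = 0"
  shows "T = Q"
proof
  fix x
  define y where "y = Q x - T x"
  have "Q y + T y = 0"
    by (simp add: y_def symmetric_op_diff Q T eq comm)
  then have "Re (cinner y (Q y)) + Re (cinner y (T y)) = 0"
    by (metis cinner_simps(2) cinner_zero_right plus_complex.simps(1) zero_complex.simps(1))
  then have "Re (cinner y (Q y)) = 0"
    using Q(2)[of y] T(2)[of y] by linarith
  then have "y = 0"
    using nonneg_op_eq_zero[OF Q] inj by blast
  then show "T x = Q x" by (simp add: y_def)
qed


subsection \<open>Square roots of positive operators\<close>

text \<open>The increments are (1 - y n)^2 / 2, so the sequence increases, and it stays below the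
  fixed point 1.\<close>

lemma quadratic_iteration:
  fixes y :: "nat \<Rightarrow> real"
  assumes y0: "y 0 = 0" and ySuc: "\<And>n. y (Suc n) = (1 + (y n)\<^sup>2) / 2"
  shows "0 \<le> y n" "y n \<le> 1" "incseq y" "Cauchy y"
proof -
  have y: "0 \<le> y n \<and> y n \<le> 1" for n
    by (induction n) (auto simp: y0 ySuc power_le_one)
  then show "0 \<le> y n" "y n \<le> 1" by auto
  have "0 \<le> (1 - y n)\<^sup>2" for n by simp
  then have "y n \<le> y (Suc n)" for n
    unfolding ySuc by (simp add: power2_eq_square algebra_simps)
  then show inc: "incseq y" by (rule incseq_SucI)
  obtain L where "y \<longlonglongrightarrow> L"
    using incseq_convergent[OF inc, of 1] y by blast
  then show "Cauchy y" by (rule LIMSEQ_imp_Cauchy)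
qed

text \<open>The iteration \<open>Y\<^sub>n\<^sub>+\<^sub>1 = (B + Y\<^sub>n\<^sup>2)/2\<close> for \<open>1 - sqrt (1 - B)\<close> is dominated by the scalar iteration
  with \<open>B = 1\<close>, so that it converges in norm even for \<open>norm B = 1\<close>. The last conclusion passes symmetry
  and commutation relations from the iterates to the limit.\<close>

lemma quadratic_equation_solution:
  fixes B :: "'a::banach \<Rightarrow>\<^sub>L 'a"
  assumes B: "norm B \<le> 1"
  obtains Y where "norm Y \<le> 1" "2 *\<^sub>R Y = B + (Y o\<^sub>L Y)"
    "\<And>P. closed P \<Longrightarrow> 0 \<in> P \<Longrightarrow> (\<And>Z. Z \<in> P \<Longrightarrow> (1/2) *\<^sub>R (B + (Z o\<^sub>L Z)) \<in> P) \<Longrightarrow> Y \<in> P"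
proof -
  note bil = bounded_bilinear_blinfun_compose
  define Y where "Y = rec_nat 0 (\<lambda>_ Z. (1/2) *\<^sub>R (B + (Z o\<^sub>L Z)))"
  define y where "y = rec_nat 0 (\<lambda>_ z::real. (1 + z\<^sup>2) / 2)"
  have Y0: "Y 0 = 0" and YSuc: "Y (Suc n) = (1/2) *\<^sub>R (B + (Y n o\<^sub>L Y n))" for n
    by (simp_all add: Y_def)
  have y0: "y 0 = 0" and ySuc: "y (Suc n) = (1 + (y n)\<^sup>2) / 2" for n
    by (simp_all add: y_def)
  note y = quadratic_iteration[of y, OF y0 ySuc]
  \<comment> \<open>Each iterate is a polynomial in \<open>B\<close>. Used twice, this shows that
    the iterates commute with one another.\<close>
  have comm: "C o\<^sub>L Y n = Y n o\<^sub>L C" if C: "C o\<^sub>L B = B o\<^sub>L C" for C n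
  proof (induction n)
    case (Suc n)
    have CB: "C (B x) = B (C x)" for x using C by (metis blinfun_apply_blinfun_compose)
    have CY: "C (Y n x) = Y n (C x)" for x using Suc by (metis blinfun_apply_blinfun_compose)
    show ?case
      by (rule blinfun_eqI) (simp add: YSuc blinfun.bilinear_simps CB CY)
  qed (simp add: Y0)
  have YY: "Y m o\<^sub>L Y n = Y n o\<^sub>L Y m" for m n
    by (rule comm) (rule comm[OF refl, symmetric])
  have Y_le: "norm (Y n) \<le> y n" for n
  proof (induction n)
    case (Suc n)
    have "norm (B + (Y n o\<^sub>L Y n)) \<le> norm B + norm (Y n) * norm (Y n)"
      using norm_triangle_ineq[of B "Y n o\<^sub>L Y n"] norm_blinfun_compose[of "Y n" "Y n"] by linarith
    also have "\<dots> \<le> 1 + y n * y n"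
      using Suc B y(1) by (intro add_mono mult_mono) auto
    finally show ?case by (simp add: YSuc ySuc power2_eq_square)
  qed (simp add: Y0 y0)
  \<comment> \<open>A difference of squares factors for commuting operators as it does for numbers,
    so the scalar increments dominate the operator increments inductively.\<close>
  have incr: "norm (Y (Suc n) - Y n) \<le> y (Suc n) - y n" for n
  proof (induction n)
    case 0
    show ?case using B by (simp add: Y0 y0 YSuc ySuc)
  next
    case (Suc n)
    have "Y (Suc (Suc n)) - Y (Suc n) = (1/2) *\<^sub>R ((Y (Suc n) o\<^sub>L Y (Suc n)) - (Y n o\<^sub>L Y n))"
      by (subst (1) YSuc, subst (3) YSuc) (simp add: scaleR_diff_right scaleR_add_right)
    also have "(Y (Suc n) o\<^sub>L Y (Suc n)) - (Y n o\<^sub>L Y n)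
        = (Y (Suc n) + Y n) o\<^sub>L (Y (Suc n) - Y n)"
      by (simp add: bounded_bilinear.add_left[OF bil] bounded_bilinear.diff_right[OF bil]
        YY[of n "Suc n"])
    finally have "norm (Y (Suc (Suc n)) - Y (Suc n))
        = norm ((Y (Suc n) + Y n) o\<^sub>L (Y (Suc n) - Y n)) / 2" by simp
    also have "\<dots> \<le> norm (Y (Suc n) + Y n) * norm (Y (Suc n) - Y n) / 2"
      by (intro divide_right_mono norm_blinfun_compose) simp
    also have "\<dots> \<le> (y (Suc n) + y n) * (y (Suc n) - y n) / 2"
      using Y_le Suc y(1)[of n] y(1)[of "Suc n"]
      by (intro divide_right_mono mult_mono norm_triangle_mono) auto
    also have "\<dots> = (1 + (y (Suc n))\<^sup>2) / 2 - (1 + (y n)\<^sup>2) / 2"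
      by (simp add: field_simps power2_eq_square)
    also have "\<dots> = y (Suc (Suc n)) - y (Suc n)"
      by (simp only: ySuc)
    finally show ?case .
  qed
  have diff: "norm (Y n - Y m) \<le> y n - y m" if "m \<le> n" for m n
    using that
  proof (induction n rule: dec_induct)
    case (step n)
    have "norm (Y (Suc n) - Y m) \<le> norm (Y (Suc n) - Y n) + norm (Y n - Y m)"
      using norm_triangle_ineq[of "Y (Suc n) - Y n" "Y n - Y m"] by simp
    then show ?case using step.IH incr[of n] by linarith
  qed simp
  have "Cauchy Y"
  proof (rule metric_CauchyI)
    fix e :: real assume "0 < e"
    then obtain N where N: "\<And>m n. m \<ge> N \<Longrightarrow> n \<ge> N \<Longrightarrow> dist (y m) (y n) < e"
      using y(4) unfolding Cauchy_def by metis
    have "dist (Y m) (Y n) < e" if "m \<ge> N" "n \<ge> N" for m n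
    proof (cases "m \<le> n")
      case True
      then show ?thesis using diff[OF True] N[OF that] by (simp add: dist_norm norm_minus_commute)
    next
      case False
      then show ?thesis using diff[of n m] N[OF that] by (simp add: dist_norm norm_minus_commute)
    qed
    then show "\<exists>N. \<forall>m\<ge>N. \<forall>n\<ge>N. dist (Y m) (Y n) < e" by blast
  qed
  then obtain Z where Z: "Y \<longlonglongrightarrow> Z"
    using Cauchy_convergent_iff convergent_def by blast
  show thesis
  proof (rule that)
    have "norm (Y n) \<le> 1" for n using Y_le[of n] y(2)[of n] by linarith
    then show "norm Z \<le> 1"
      by (intro LIMSEQ_le_const2[OF tendsto_norm[OF Z]]) blast
    have "(\<lambda>n. Y (Suc n)) \<longlonglongrightarrow> (1/2) *\<^sub>R (B + (Z o\<^sub>L Z))"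
      unfolding YSuc by (intro tendsto_intros bounded_bilinear.tendsto[OF bil] Z)
    then have "Z = (1/2) *\<^sub>R (B + (Z o\<^sub>L Z))"
      by (rule LIMSEQ_unique[OF LIMSEQ_Suc[OF Z]])
    then have "2 *\<^sub>R Z = 2 *\<^sub>R ((1/2) *\<^sub>R (B + (Z o\<^sub>L Z)))"
      by (rule arg_cong)
    then show "2 *\<^sub>R Z = B + (Z o\<^sub>L Z)"
      by simp
    fix P assume P: "closed P" "0 \<in> P" "\<And>Z. Z \<in> P \<Longrightarrow> (1/2) *\<^sub>R (B + (Z o\<^sub>L Z)) \<in> P"
    have "Y n \<in> P" for n
      by (induction n) (simp_all add: Y0 YSuc P(2,3) del: scaleR_add_right)
    then show "Z \<in> P" using P(1) Z closed_sequentially by blast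
  qed
qed

text \<open>Needed to let symmetry pass to the limit in
  \<open>quadratic_equation_solution\<close>.\<close>

lemma closed_symmetric_op: "closed {Z :: 'a::chilbert_space \<Rightarrow>\<^sub>L 'a. symmetric_op (blinfun_apply Z)}"
  unfolding closed_sequential_limits
proof (intro allI impI, elim conjE)
  fix W :: "nat \<Rightarrow> 'a \<Rightarrow>\<^sub>L 'a" and Z
  assume W: "\<forall>n. W n \<in> {Z. symmetric_op (blinfun_apply Z)}" "W \<longlonglongrightarrow> Z"
  have lim: "(\<lambda>n. W n x) \<longlonglongrightarrow> Z x" for x
    by (intro tendsto_intros W)
  have "cinner (Z x) y = cinner x (Z y)" for x y
  proof (rule LIMSEQ_unique)
    show "(\<lambda>n. cinner (W n x) y) \<longlonglongrightarrow> cinner (Z x) y"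
      by (intro tendsto_cinner lim tendsto_const)
    have "(\<lambda>n. cinner x (W n y)) \<longlonglongrightarrow> cinner x (Z y)"
      by (intro tendsto_cinner lim tendsto_const)
    then show "(\<lambda>n. cinner (W n x) y) \<longlonglongrightarrow> cinner x (Z y)"
      using W(1) by (simp add: symmetric_op_def)
  qed
  then show "Z \<in> {Z. symmetric_op (blinfun_apply Z)}"
    by (simp add: symmetric_op_def)
qed

lemma cinner_scaleR_left: "cinner (r *\<^sub>R x) y = complex_of_real r * cinner (x::'a::chilbert_space) y"
  and cinner_scaleR_right: "cinner x (r *\<^sub>R y) = complex_of_real r * cinner (x::'a::chilbert_space) y"
  by (simp_all add: scaleR_scaleC cinner_simps)

lemma norm_add_scaleR_squared:
  "(norm (x + r *\<^sub>R y))\<^sup>2 = (norm x)\<^sup>2 + 2 * r * Re (cinner x y) + r\<^sup>2 * (norm (y::'a::chilbert_space))\<^sup>2"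
  using cinner.expand[of x y "complex_of_real r"]
  by (simp add: cinner_self scaleR_scaleC)

text \<open>The hypothesis says that c R lies between 0 and 1. Hence B = 1 - c R is a contraction,
  the iteration gives Y = 1 - sqrt (c R), and (1 - Y) / sqrt c is the root of
  \<open>R\<close>.\<close>

lemma symmetric_op_sqrt:
  fixes R :: "'a::chilbert_space \<Rightarrow> 'a"
  assumes R: "symmetric_op R" and c: "0 < c"
    and pos: "\<And>x. c * (norm (R x))\<^sup>2 \<le> Re (cinner x (R x))"
  obtains Q K where "symmetric_op Q" "\<And>x. norm (Q x) \<le> K * norm x"
    "\<And>x. 0 \<le> Re (cinner x (Q x))" "\<And>x. Q (Q x) = R x"
    "\<And>T x. bounded_linear T \<Longrightarrow> (\<And>x. T (R x) = R (T x)) \<Longrightarrow> T (Q x) = Q (T x)"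
proof -
  have Rbound: "norm (R x) \<le> (1 / c) * norm x" for x
  proof (cases "R x = 0")
    case False
    have "c * (norm (R x) * norm (R x)) \<le> norm x * norm (R x)"
      using pos[of x] complex_Re_le_cmod[of "cinner x (R x)"] norm_cinner_le[of x "R x"]
      by (simp add: power2_eq_square)
    then show ?thesis using False c by (simp add: field_simps)
  qed (use c in simp)
  have Rbl: "bounded_linear R"
    using symmetric_op_bounded_clinear[OF R Rbound] by (simp add: bounded_clinear_def)
  define B where "B = Blinfun (\<lambda>x. x - c *\<^sub>R R x)"
  have B_apply: "blinfun_apply B = (\<lambda>x. x - c *\<^sub>R R x)"
    unfolding B_def
    by (intro bounded_linear_Blinfun_apply bounded_linear_sub bounded_linear_ident
      bounded_linear_compose[OF bounded_linear_scaleR_right Rbl])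
  have "norm B \<le> 1"
  proof (rule norm_blinfun_bound)
    fix x
    \<comment> \<open>|x - c R x|^2 = |x|^2 - 2 c <x, R x> + c^2 |R x|^2, and the last term is at
      most c <x, R x>.\<close>
    have "c * (c * (norm (R x))\<^sup>2) \<le> c * Re (cinner x (R x))"
      using pos c by (intro mult_left_mono) auto
    moreover have "0 \<le> c * Re (cinner x (R x))"
      using pos[of x] c by (meson mult_nonneg_nonneg less_imp_le order_trans zero_le_power2)
    ultimately have "(norm (B x))\<^sup>2 \<le> (norm x)\<^sup>2"
      using norm_add_scaleR_squared[of x "- c" "R x"] by (simp add: B_apply power2_eq_square)
    then show "norm (B x) \<le> 1 * norm x" by (simp add: power2_le_iff_abs_le)
  qed simp
  then obtain Y where Y: "norm Y \<le> 1" "2 *\<^sub>R Y = B + (Y o\<^sub>L Y)"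
    and closed: "\<And>P. closed P \<Longrightarrow> 0 \<in> P \<Longrightarrow>
      (\<And>Z. Z \<in> P \<Longrightarrow> (1/2) *\<^sub>R (B + (Z o\<^sub>L Z)) \<in> P) \<Longrightarrow> Y \<in> P"
    using quadratic_equation_solution[of B] by metis
  have Ysym: "symmetric_op Y"
  proof -
    have "Y \<in> {Z. symmetric_op (blinfun_apply Z)}"
    proof (rule closed[OF closed_symmetric_op])
      fix Z :: "'a \<Rightarrow>\<^sub>L 'a"
      assume "Z \<in> {Z. symmetric_op (blinfun_apply Z)}"
      then have Z: "symmetric_op Z" by simp
      show "(1/2) *\<^sub>R (B + (Z o\<^sub>L Z)) \<in> {Z. symmetric_op (blinfun_apply Z)}"
        by (simp add: symmetric_op_def blinfun.bilinear_simps cinner_simps cinner_scaleR_left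
          cinner_scaleR_right B_apply symmetric_opD[OF R] symmetric_opD[OF Z])
    qed (simp add: symmetric_op_def)
    then show ?thesis by simp
  qed
  have Yeq: "Y x + Y x = x - c *\<^sub>R R x + Y (Y x)" for x
    using arg_cong[OF Y(2), of "\<lambda>Z. blinfun_apply Z x"]
    by (simp add: blinfun.bilinear_simps B_apply scaleR_2)
  define s where "s = 1 / sqrt c"
  have s: "0 < s" "s * s * c = 1" using c by (simp_all add: s_def)
  show thesis
  proof (rule that)
    let ?Q = "\<lambda>x. s *\<^sub>R (x - Y x)"
    show "symmetric_op ?Q"
      by (simp add: symmetric_op_def cinner_simps cinner_scaleR_left cinner_scaleR_right
        symmetric_opD[OF Ysym])
    have Ybound: "norm (Y x) \<le> norm x" for x
      using norm_blinfun[of Y x] mult_right_mono[OF Y(1) norm_ge_zero[of x]] by simp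
    show "norm (?Q x) \<le> (s * 2) * norm x" for x
      using norm_triangle_ineq4[of x "Y x"] Ybound[of x] s(1) by simp
    show "0 \<le> Re (cinner x (?Q x))" for x
    proof -
      have "Re (cinner x (Y x)) \<le> norm x * norm x"
        using complex_Re_le_cmod[of "cinner x (Y x)"] norm_cinner_le[of x "Y x"]
          mult_left_mono[OF Ybound[of x] norm_ge_zero[of x]] by linarith
      then show ?thesis
        using s(1) by (simp add: cinner_simps cinner_scaleR_right cinner_self power2_eq_square)
    qed
    show "?Q (?Q x) = R x" for x
    proof -
      have "?Q (?Q x) = (s * s) *\<^sub>R (x - (Y x + Y x) + Y (Y x))"
        by (simp add: blinfun.bilinear_simps algebra_simps)
      also have "\<dots> = (s * s * c) *\<^sub>R R x"
        unfolding Yeq by simp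
      finally show ?thesis using s(2) by simp
    qed
    show "T (?Q x) = ?Q (T x)" if T: "bounded_linear T" and TR: "\<And>x. T (R x) = R (T x)" for T x
    proof -
      interpret T: bounded_linear T by (rule T)
      define C where "C = Blinfun T"
      have C: "blinfun_apply C = T"
        unfolding C_def by (rule bounded_linear_Blinfun_apply[OF T])
      \<comment> \<open>The commutant of \<open>T\<close> is closed and, as \<open>T\<close>
        commutes with \<open>B\<close>, invariant under the iteration step; so it contains the
        limit.\<close>
      have "Y \<in> {Z. C o\<^sub>L Z = Z o\<^sub>L C}"
      proof (rule closed)
        show "closed {Z. C o\<^sub>L Z = Z o\<^sub>L C}"
          by (intro closed_Collect_eq continuous_intros
            bounded_bilinear.continuous_on[OF bounded_bilinear_blinfun_compose])
        fix Z :: "'a \<Rightarrow>\<^sub>L 'a"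
        assume "Z \<in> {Z. C o\<^sub>L Z = Z o\<^sub>L C}"
        then have CZ: "T (Z x) = Z (T x)" for x
          using C by (metis (mono_tags) blinfun_apply_blinfun_compose mem_Collect_eq)
        show "(1/2) *\<^sub>R (B + (Z o\<^sub>L Z)) \<in> {Z. C o\<^sub>L Z = Z o\<^sub>L C}"
          by (auto intro!: blinfun_eqI
            simp: blinfun.bilinear_simps C B_apply CZ TR T.add T.diff T.scaleR)
      qed simp
      then have "T (Y x) = Y (T x)"
        using C by (metis (mono_tags) blinfun_apply_blinfun_compose mem_Collect_eq)
      then show ?thesis by (simp add: T.diff T.scaleR)
    qed
  qed
qed

section \<open>Self-adjoint partial operators and inverses of symmetric operators\<close>

definition inverse_op :: "('a \<Rightarrow> 'a) \<Rightarrow> 'a partial_op" where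
  "inverse_op T x = (if x \<in> range T then Some (inv T x) else None)"

lemma dom_inverse_op: "dom (inverse_op T) = range T"
  by (auto simp: inverse_op_def dom_def)

lemma inverse_op_eq_Some_iff: "inj T \<Longrightarrow> inverse_op T x = Some z \<longleftrightarrow> x = T z"
  by (auto simp: inverse_op_def)

lemma inverse_op_apply [simp]: "inj T \<Longrightarrow> inverse_op T (T z) = Some z"
  by (simp add: inverse_op_eq_Some_iff)

lemma symmetric_op_inj:
  assumes "symmetric_op T" "\<And>x. T x = 0 \<Longrightarrow> x = 0"
  shows "inj T"
proof (rule injI)
  fix x y assume "T x = T y"
  then have "T (x - y) = 0" by (simp add: symmetric_op_diff assms(1))
  then show "x = y" using assms(2) by fastforce
qed

text \<open>Density makes the definite description in \<open>op_adjoint\<close> well determined, so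
  the adjoint can be handled through its graph.\<close>

lemma op_adjoint_eq_Some_iff:
  fixes T :: "'a::chilbert_space partial_op"
  assumes "closure (dom T) = UNIV"
  shows "op_adjoint T y = Some z \<longleftrightarrow> (\<forall>x\<in>dom T. cinner z x = cinner y (the (T x)))"
proof -
  have uniq: "w = z" if "\<forall>x\<in>dom T. cinner z x = cinner y (the (T x))"
    "\<forall>x\<in>dom T. cinner w x = cinner y (the (T x))" for w z
    using that by - (rule cinner_eqI_dense[OF assms], simp)
  show ?thesis
  proof
    assume "op_adjoint T y = Some z"
    then have ex: "\<exists>z. \<forall>x\<in>dom T. cinner z x = cinner y (the (T x))"
      and z: "z = (THE z. \<forall>x\<in>dom T. cinner z x = cinner y (the (T x)))"
      by (auto simp: op_adjoint_def split: if_splits)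
    from ex obtain w where w: "\<forall>x\<in>dom T. cinner w x = cinner y (the (T x))" by blast
    have "(THE z. \<forall>x\<in>dom T. cinner z x = cinner y (the (T x))) = w"
      using w uniq by (intro the_equality) blast+
    with w z show "\<forall>x\<in>dom T. cinner z x = cinner y (the (T x))" by simp
  next
    assume z: "\<forall>x\<in>dom T. cinner z x = cinner y (the (T x))"
    then have "(THE z. \<forall>x\<in>dom T. cinner z x = cinner y (the (T x))) = z"
      using uniq by (intro the_equality) blast+
    with z show "op_adjoint T y = Some z" by (auto simp: op_adjoint_def)
  qed
qed

lemma partial_op_eqI: "(\<And>x z. S x = Some z \<longleftrightarrow> T x = Some z) \<Longrightarrow> S = T"
  by (metis ext not_Some_eq)

lemma self_adjointD:
  fixes S :: "'a::chilbert_space partial_op"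
  assumes S: "self_adjoint S" and "x \<in> dom S" "y \<in> dom S"
  shows "cinner (the (S x)) y = cinner x (the (S y))"
proof -
  have "op_adjoint S x = Some (the (S x))"
    using assms by (auto simp: self_adjoint_def)
  then show ?thesis
    using assms op_adjoint_eq_Some_iff[of S] by (auto simp: self_adjoint_def)
qed

text \<open>Tested on the vectors T u of the domain, the adjoint relation reads <z, T u> = <y, u>,
  which by symmetry means y = T z: the graph of the inverse itself.\<close>

lemma self_adjoint_inverse_op:
  assumes T: "symmetric_op T" and inj: "\<And>x. T x = 0 \<Longrightarrow> x = 0"
  shows "self_adjoint (inverse_op T)"
proof -
  note injT = symmetric_op_inj[OF T inj]
  have dense: "closure (dom (inverse_op T)) = UNIV"
    unfolding dom_inverse_op by (rule dense_range[OF T inj])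
  have "linear_op (inverse_op T)"
    unfolding linear_op_def dom_inverse_op
    using csubspace_range[OF T] injT
    by (auto simp: symmetric_op_add[OF T, symmetric] symmetric_op_scaleC[OF T, symmetric])
  moreover have "op_adjoint (inverse_op T) = inverse_op T"
  proof (rule partial_op_eqI)
    fix y z
    have "op_adjoint (inverse_op T) y = Some z \<longleftrightarrow> (\<forall>u. cinner (T z) u = cinner y u)"
      using injT by (simp add: op_adjoint_eq_Some_iff[OF dense] dom_inverse_op symmetric_opD[OF T])
    also have "\<dots> \<longleftrightarrow> y = T z"
      using cinner_eqI_left by metis
    finally show "op_adjoint (inverse_op T) y = Some z \<longleftrightarrow> inverse_op T y = Some z"
      by (simp add: inverse_op_eq_Some_iff[OF injT])
  qed
  ultimately show ?thesis using dense by (simp add: self_adjoint_def)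
qed

lemma self_adjoint_total_iff: "self_adjoint (\<lambda>x. Some (H x)) \<longleftrightarrow> symmetric_op H"
proof
  assume "self_adjoint (\<lambda>x. Some (H x))"
  from self_adjointD[OF this] show "symmetric_op H"
    by (simp add: symmetric_op_def dom_def)
next
  assume H: "symmetric_op H"
  have dom: "dom (\<lambda>x. Some (H x)) = UNIV" by auto
  have "op_adjoint (\<lambda>x. Some (H x)) = (\<lambda>x. Some (H x))"
  proof (rule partial_op_eqI)
    fix y z
    have "op_adjoint (\<lambda>x. Some (H x)) y = Some z \<longleftrightarrow> (\<forall>x. cinner z x = cinner (H y) x)"
      by (simp add: op_adjoint_eq_Some_iff dom symmetric_opD[OF H])
    also have "\<dots> \<longleftrightarrow> H y = z"
      using cinner_eqI_left by metis
    finally show "op_adjoint (\<lambda>x. Some (H x)) y = Some z \<longleftrightarrow> Some (H y) = Some z" by simp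
  qed
  then show "self_adjoint (\<lambda>x. Some (H x))"
    by (simp add: self_adjoint_def linear_op_def dom csubspace_UNIV symmetric_op_add[OF H]
      symmetric_op_scaleC[OF H])
qed

subsection \<open>The representation theorems\<close>

lemma linear_op_diff:
  assumes "linear_op T" "x \<in> dom T" "y \<in> dom T"
  shows "x - y \<in> dom T" "the (T (x - y)) = the (T x) - the (T y)"
proof -
  have dom: "csubspace (dom T)" using assms(1) by (simp add: linear_op_def)
  then show "x - y \<in> dom T" using assms(2,3) by (rule csubspace_diff)
  have "the (T (x + (- 1) *\<^sub>C y)) = the (T x) + (- 1) *\<^sub>C the (T y)"
    using assms csubspace_scaleC[OF dom assms(3), of "- 1"] unfolding linear_op_def by simp
  then show "the (T (x - y)) = the (T x) - the (T y)"
    by (simp add: scaleC_minus1)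
qed

text \<open>Existence is direct. For uniqueness, any other root is shown to be the inverse of an
  everywhere defined nonnegative symmetric \<open>T\<close> with the same square as
  \<open>Q\<close>, and \<open>nonneg_sqrt_unique\<close> applies.\<close>

lemma op_sqrt_inverse_op:
  fixes Q :: "'a::chilbert_space \<Rightarrow> 'a"
  assumes Q: "symmetric_op Q" "\<And>x. 0 \<le> Re (cinner x (Q x))" and inj: "\<And>x. Q x = 0 \<Longrightarrow> x = 0"
    and bound: "\<And>x. norm (Q x) \<le> K * norm x"
    and comm: "\<And>T x. bounded_linear T \<Longrightarrow> (\<And>x. T (Q (Q x)) = Q (Q (T x))) \<Longrightarrow> T (Q x) = Q (T x)"
  shows "op_sqrt (inverse_op (\<lambda>x. Q (Q x))) = inverse_op Q"
proof -
  define R where "R x = Q (Q x)" for x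
  note injQ = symmetric_op_inj[OF Q(1) inj]
  have R: "symmetric_op R" and R_inj: "R x = 0 \<Longrightarrow> x = 0" for x
    using inj by (auto simp: symmetric_op_def R_def symmetric_opD[OF Q(1)])
  have injR: "inj R" by (rule symmetric_op_inj[OF R R_inj])
  have "op_sqrt (inverse_op R) = inverse_op Q"
    unfolding op_sqrt_def
  proof (rule the_equality, intro conjI)
    show "self_adjoint (inverse_op Q)"
      by (rule self_adjoint_inverse_op[OF Q(1) inj])
    show "nonneg_op (inverse_op Q)"
      using injQ Q(2) by (auto simp: nonneg_op_def dom_inverse_op symmetric_opD[OF Q(1)])
    show "inverse_op Q \<circ>\<^sub>m inverse_op Q = inverse_op R"
    proof (rule partial_op_eqI)
      fix x z
      have "(inverse_op Q \<circ>\<^sub>m inverse_op Q) x = Some z \<longleftrightarrow> x = R z"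
        by (auto simp: map_comp_Some_iff inverse_op_eq_Some_iff[OF injQ] R_def)
      then show "(inverse_op Q \<circ>\<^sub>m inverse_op Q) x = Some z \<longleftrightarrow> inverse_op R x = Some z"
        by (simp only: inverse_op_eq_Some_iff[OF injR])
    qed
  next
    fix S :: "'a partial_op"
    assume "self_adjoint S \<and> nonneg_op S \<and> S \<circ>\<^sub>m S = inverse_op R"
    then have sa: "self_adjoint S" and nonneg: "nonneg_op S"
      and SS: "\<And>x z. (S \<circ>\<^sub>m S) x = Some z \<longleftrightarrow> x = R z"
      by (auto simp: inverse_op_eq_Some_iff[OF injR])
    have lin: "linear_op S" using sa by (simp add: self_adjoint_def)
    \<comment> \<open>As \<open>S\<close> applied twice to \<open>R z\<close> gives
      \<open>z\<close>, the intermediate value is a preimage of \<open>z\<close> under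
      \<open>S\<close>, so \<open>T\<close> is the candidate for the inverse of
      \<open>S\<close>.\<close>
    define T where "T z = the (S (R z))" for z
    have T: "S (R z) = Some (T z)" "S (T z) = Some z" for z
      using SS[of "R z" z] by (auto simp: map_comp_Some_iff T_def)
    have S0: "S 0 = Some 0"
      using linear_op_diff[OF lin, of "T 0" "T 0"] T(2)[of 0] by force
    \<comment> \<open>Injectivity of \<open>S\<close>: two preimages of \<open>z\<close> differ by a
      vector that \<open>S\<close>, and hence its square, sends to 0. Such a vector is R 0 =
      0.\<close>
    have S_iff: "S y = Some z \<longleftrightarrow> y = T z" for y z
    proof
      assume y: "S y = Some z"
      have dom: "y \<in> dom S" "T z \<in> dom S" using y T(2)[of z] by blast+
      have "y - T z \<in> dom S" "the (S (y - T z)) = 0"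
        using linear_op_diff[OF lin dom] y T(2)[of z] by simp_all
      then have "S (y - T z) = Some 0" by auto
      then have "(S \<circ>\<^sub>m S) (y - T z) = Some 0"
        using S0 by (simp add: map_comp_Some_iff)
      then show "y = T z" by (simp add: SS symmetric_op_zero[OF R])
    qed (simp add: T)
    have Tsym: "symmetric_op T"
      unfolding symmetric_op_def
    proof (intro allI)
      fix u v
      have "T u \<in> dom S" "T v \<in> dom S" using T(2) by blast+
      from self_adjointD[OF sa this] show "cinner (T u) v = cinner u (T v)"
        by (simp add: T(2))
    qed
    have TT: "T (T x) = R x" for x
      using T(1) S_iff by metis
    have Tpos: "0 \<le> Re (cinner x (T x))" for x
    proof -
      have "T x \<in> dom S" using T(2) by blast
      then have "0 \<le> Re (cinner (T x) (the (S (T x))))"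
        using nonneg unfolding nonneg_op_def by blast
      then show ?thesis by (simp add: T(2) symmetric_opD[OF Tsym])
    qed
    \<comment> \<open>Both squared norms equal <x, R x>. This transfers the bound of
      \<open>Q\<close> to \<open>T\<close>.\<close>
    have "norm (T x) = norm (Q x)" for x
    proof -
      have "cinner (T x) (T x) = cinner (Q x) (Q x)"
        by (simp add: symmetric_opD[OF Tsym] symmetric_opD[OF Q(1)] TT R_def)
      then show ?thesis by (simp add: cinner_self del: of_real_power)
    qed
    then have "bounded_linear T"
      using symmetric_op_bounded_clinear[OF Tsym, of K] bound by (simp add: bounded_clinear_def)
    \<comment> \<open>\<open>T\<close> commutes with its own square \<open>R\<close>, hence with
      \<open>Q\<close> by \<open>comm\<close>.\<close>
    then have "T (Q x) = Q (T x)" for x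
      by (rule comm) (simp add: TT[unfolded R_def, symmetric])
    then have "T = Q"
      using TT by (intro nonneg_sqrt_unique[OF Q Tsym Tpos _ _ inj]) (auto simp: R_def)
    then show "S = inverse_op Q"
      by (intro partial_op_eqI) (simp add: S_iff inverse_op_eq_Some_iff[OF injQ])
  qed
  then show ?thesis by (simp add: R_def[abs_def])
qed

lemma associated_op_eq_Some_iff:
  fixes D :: "'a::chilbert_space set"
  assumes "closure D = UNIV"
  shows "associated_op D a x = Some z \<longleftrightarrow> x \<in> D \<and> (\<forall>y\<in>D. a y x = cinner y z)"
proof -
  have uniq: "w = z" if "\<forall>y\<in>D. a y x = cinner y z" "\<forall>y\<in>D. a y x = cinner y w" for w z
  proof (rule cinner_eqI_dense[OF assms])
    fix y assume "y \<in> D"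
    then have "cinner y w = cinner y z" using that by simp
    then show "cinner w y = cinner z y" by (metis cinner_commute)
  qed
  show ?thesis
  proof (cases "\<exists>z. \<forall>y\<in>D. a y x = cinner y z")
    case True
    then obtain w where w: "\<forall>y\<in>D. a y x = cinner y w" by blast
    then have "(THE z. \<forall>y\<in>D. a y x = cinner y z) = w"
      using uniq by (intro the_equality) blast+
    then show ?thesis
      using w uniq True by (auto simp: associated_op_def)
  qed (auto simp: associated_op_def)
qed

section \<open>The inverse of the associated operator and the square root\<close>

context closed_positive_form
begin

text \<open>Positive definiteness makes y -> <f, y> bounded in the form norm, and \<open>R f\<close>
  is its Riesz vector. The lower bound is c |R x|^2 \<le> a[R x, R x] = <x, R x>, in the shape that
  \<open>symmetric_op_sqrt\<close> requires.\<close>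

lemma form_inverse:
  assumes dense: "closure D = UNIV"
  obtains R c where "symmetric_op R" "0 < c" "\<And>x. c * (norm (R x))\<^sup>2 \<le> Re (cinner x (R x))"
    "\<And>x. R x \<in> D" "\<And>x y. y \<in> D \<Longrightarrow> a (R x) y = cinner x y" "\<And>x. R x = 0 \<Longrightarrow> x = 0"
    "associated_op D a = inverse_op R"
proof -
  obtain c where c: "0 < c" "\<And>x. x \<in> D \<Longrightarrow> c * (norm x)\<^sup>2 \<le> Re (a x x)"
    using bounded_below by blast
  have "\<exists>z\<in>D. \<forall>y\<in>D. cinner f y = a z y" for f
  proof -
    have bound: "cmod (cinner f y) \<le> (norm f / sqrt c) * sqrt (Re (a y y))" if "y \<in> D" for y
    proof -
      have "sqrt c * norm y \<le> sqrt (Re (a y y))"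
        using real_sqrt_le_mono[OF c(2)[OF that]] by (simp add: real_sqrt_mult)
      then have "norm y \<le> sqrt (Re (a y y)) / sqrt c"
        using c(1) by (simp add: field_simps)
      then have "norm f * norm y \<le> norm f * (sqrt (Re (a y y)) / sqrt c)"
        by (intro mult_left_mono) auto
      then show ?thesis using norm_cinner_le[of f y] by simp
    qed
    obtain z where "z \<in> D" "\<And>y. y \<in> D \<Longrightarrow> cinner f y = a z y"
      by (rule Riesz_representation[of "cinner f", OF _ _ bound]) (auto simp: cinner_simps)
    then show ?thesis by blast
  qed
  then obtain R where RD: "\<And>f. R f \<in> D" and R: "\<And>f y. y \<in> D \<Longrightarrow> a (R f) y = cinner f y"
    by metis
  have sym: "symmetric_op R"
    unfolding symmetric_op_def
  proof (intro allI)
    fix f g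
    have "cinner (R f) g = cnj (a (R g) (R f))"
      using R[OF RD] cinner_commute by metis
    also have "\<dots> = cinner f (R g)"
      using R[OF RD] commute[OF RD RD] by metis
    finally show "cinner (R f) g = cinner f (R g)" .
  qed
  have inj: "x = 0" if "R x = 0" for x
  proof (rule cinner_eqI_dense[OF dense])
    fix y assume y: "y \<in> D"
    have "a 0 y = 0" using diff_left[OF mem(1) mem(1) y] by simp
    then show "cinner x y = cinner 0 y" using R[OF y, of x] that by simp
  qed
  have "associated_op D a = inverse_op R"
  proof (rule partial_op_eqI)
    fix x z
    have "(x \<in> D \<and> (\<forall>y\<in>D. a y x = cinner y z)) \<longleftrightarrow> x = R z"
    proof
      assume x: "x \<in> D \<and> (\<forall>y\<in>D. a y x = cinner y z)"
      have "cinner x f = cinner (R z) f" for f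
      proof -
        \<comment> \<open>The relation defining the associated operator is tested with y = R
          f.\<close>
        have "cinner f x = a (R f) x" using x R by simp
        also have "\<dots> = cinner (R f) z" using x RD by blast
        also have "\<dots> = cinner f (R z)" by (rule symmetric_opD[OF sym])
        finally show ?thesis by (metis cinner_commute)
      qed
      then show "x = R z" by (rule cinner_eqI_left)
    next
      assume x: "x = R z"
      have "a y (R z) = cinner y z" if "y \<in> D" for y
        using commute[OF that RD] R[OF that] cinner_commute by metis
      then show "x \<in> D \<and> (\<forall>y\<in>D. a y x = cinner y z)"
        using RD x by blast
    qed
    then show "associated_op D a x = Some z \<longleftrightarrow> inverse_op R x = Some z"
      by (simp add: associated_op_eq_Some_iff[OF dense] inverse_op_eq_Some_iff
        symmetric_op_inj[OF sym inj])
  qed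
  moreover have "c * (norm (R x))\<^sup>2 \<le> Re (cinner x (R x))" for x
    using c(2)[OF RD] R[OF RD] by simp
  ultimately show thesis
    using that sym c(1) RD R inj by blast
qed

lemma second_representation:
  assumes dense: "closure D = UNIV"
  obtains Q where "symmetric_op Q" "\<And>x. Q x = 0 \<Longrightarrow> x = 0"
    "op_sqrt (associated_op D a) = inverse_op Q" "range Q = D" "\<And>u v. a (Q u) (Q v) = cinner u v"
proof -
  obtain R c where R: "symmetric_op R" "0 < c" "\<And>x. c * (norm (R x))\<^sup>2 \<le> Re (cinner x (R x))"
    "\<And>x. R x \<in> D" "\<And>x y. y \<in> D \<Longrightarrow> a (R x) y = cinner x y" "\<And>x. R x = 0 \<Longrightarrow> x = 0"
    and assoc: "associated_op D a = inverse_op R"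
    using form_inverse[OF dense] by blast
  obtain Q K where Q: "symmetric_op Q" "\<And>x. norm (Q x) \<le> K * norm x"
    "\<And>x. 0 \<le> Re (cinner x (Q x))" "\<And>x. Q (Q x) = R x"
    "\<And>T x. bounded_linear T \<Longrightarrow> (\<And>x. T (R x) = R (T x)) \<Longrightarrow> T (Q x) = Q (T x)"
    using symmetric_op_sqrt[OF R(1-3)] by blast
  have inj: "x = 0" if "Q x = 0" for x
    using R(6)[of x] Q(4)[of x] that symmetric_op_zero[OF Q(1)] by simp
  have "bounded_linear Q"
    using symmetric_op_bounded_clinear[OF Q(1,2)] by (simp add: bounded_clinear_def)
  then interpret Q: bounded_linear Q .
  \<comment> \<open>As R = Q Q, this is the claimed identity a[Q u, Q v] = <u, v> for u and v in the
    range of \<open>Q\<close>.\<close>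
  have aR: "a (R u) (R v) = cinner (Q u) (Q v)" for u v
    using R(4,5) Q(4) by (simp add: symmetric_opD[OF Q(1)])
  \<comment> \<open>Choose Q (w n) -> u by density. By \<open>aR\<close> the vectors R (w n) are
    Cauchy in the form norm, and their limit is Q u because Q is continuous.\<close>
  have approx: "\<exists>w. Q u \<in> D \<and> (\<lambda>n. Q (w n)) \<longlonglongrightarrow> u
      \<and> (\<lambda>n. Re (a (R (w n) - Q u) (R (w n) - Q u))) \<longlonglongrightarrow> 0" for u
  proof -
    have "u \<in> closure (range Q)" using dense_range[OF Q(1) inj] by simp
    then obtain s where s: "\<And>n. s n \<in> range Q" "s \<longlonglongrightarrow> u"
      unfolding closure_sequential by blast
    then obtain w where w: "s = (\<lambda>n. Q (w n))"
      by (metis (mono_tags) ext f_inv_into_f)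
    have lim: "(\<lambda>n. Q (w n)) \<longlonglongrightarrow> u" using s(2) w by simp
    have "\<exists>N. \<forall>m\<ge>N. \<forall>n\<ge>N. Re (a (R (w m) - R (w n)) (R (w m) - R (w n))) < e" if "0 < e" for e
    proof -
      have "0 < sqrt e" using that by simp
      with LIMSEQ_imp_Cauchy[OF lim]
      obtain N where N: "\<And>m n. m \<ge> N \<Longrightarrow> n \<ge> N \<Longrightarrow> dist (Q (w m)) (Q (w n)) < sqrt e"
        unfolding Cauchy_def by blast
      have "Re (a (R (w m) - R (w n)) (R (w m) - R (w n))) < e" if "m \<ge> N" "n \<ge> N" for m n
      proof -
        have "Re (a (R (w m) - R (w n)) (R (w m) - R (w n))) = (dist (Q (w m)) (Q (w n)))\<^sup>2"
          by (simp add: symmetric_op_diff[OF R(1), symmetric] aR cinner_self dist_norm Q.diff)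
        also have "\<dots> < (sqrt e)\<^sup>2"
          using N[OF that] by (intro power_strict_mono) auto
        finally show ?thesis using \<open>0 < e\<close> by simp
      qed
      then show ?thesis by blast
    qed
    then obtain x where x: "x \<in> D" "(\<lambda>n. Re (a (R (w n) - x) (R (w n) - x))) \<longlonglongrightarrow> 0"
      "(\<lambda>n. R (w n)) \<longlonglongrightarrow> x"
      by (rule complete[OF R(4)])
    have "(\<lambda>n. R (w n)) \<longlonglongrightarrow> Q u"
      using Q.tendsto[OF lim] by (simp add: Q(4))
    then have "x = Q u" using x(3) LIMSEQ_unique by blast
    then show ?thesis using x lim by blast
  qed
  then have QD: "Q u \<in> D" for u by blast
  have aQ: "a (Q u) (Q v) = cinner u v" for u v
  proof -
    obtain w where w: "(\<lambda>n. Q (w n)) \<longlonglongrightarrow> u"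
      "(\<lambda>n. Re (a (R (w n) - Q u) (R (w n) - Q u))) \<longlonglongrightarrow> 0" using approx by blast
    obtain z where z: "(\<lambda>n. Q (z n)) \<longlonglongrightarrow> v"
      "(\<lambda>n. Re (a (R (z n) - Q v) (R (z n) - Q v))) \<longlonglongrightarrow> 0" using approx by blast
    have "(\<lambda>n. a (R (w n)) (R (z n))) \<longlonglongrightarrow> a (Q u) (Q v)"
      by (rule tendsto_form[OF R(4) R(4) QD QD w(2) z(2)])
    moreover have "(\<lambda>n. a (R (w n)) (R (z n))) \<longlonglongrightarrow> cinner u v"
      unfolding aR by (rule tendsto_cinner[OF w(1) z(1)])
    ultimately show ?thesis by (rule LIMSEQ_unique)
  qed
  have "x \<in> range Q" if x: "x \<in> D" for x
  proof -
    have bound: "cmod (a x (Q f)) \<le> sqrt (Re (a x x)) * sqrt (Re (cinner f f))" for f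
      using Cauchy_Schwarz[OF x QD[of f]] by (simp add: aQ)
    \<comment> \<open>The functional f -> a[x, Q f] is bounded because \<open>Q\<close> is isometric
      from the norm to the form norm. Its Riesz vector \<open>u\<close> is the preimage of
      \<open>x\<close>, as testing with f = Q g shows.\<close>
    obtain u where u: "\<And>f. a x (Q f) = cinner u f"
      by (rule cinner.Riesz_representation[of "\<lambda>f. a x (Q f)", OF _ _ bound])
        (auto simp: symmetric_op_add[OF Q(1)] symmetric_op_scaleC[OF Q(1)] add_right scaleC_right x QD)
    have "cinner x g = cinner (Q u) g" for g
    proof -
      have "cinner g x = a (R g) x" using R(5)[OF x] by simp
      also have "\<dots> = cnj (a x (R g))" by (rule commute[OF R(4) x])
      also have "\<dots> = cnj (cinner (Q u) g)"
        using u[of "Q g"] by (simp add: Q(4) symmetric_opD[OF Q(1)])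
      finally show ?thesis by (metis cinner_commute)
    qed
    then have "x = Q u" by (rule cinner_eqI_left)
    then show ?thesis by blast
  qed
  then have "range Q = D" using QD by blast
  moreover have "op_sqrt (associated_op D a) = inverse_op Q"
    using op_sqrt_inverse_op[OF Q(1,3) inj Q(2)] Q(5) unfolding assoc Q(4) by simp
  ultimately show thesis using that Q(1) inj aQ by blast
qed

end

section \<open>Bounded and coercive symmetric forms on the whole space\<close>

lemma bounded_symmetric_form_representation:
  fixes h :: "'a::chilbert_space \<Rightarrow> 'a \<Rightarrow> complex"
  assumes h: "sesquilinear_form UNIV h" "symmetric_form UNIV h"
    and bound: "\<And>u v. cmod (h u v) \<le> \<beta> * norm u * norm v" and "0 \<le> \<beta>"
  obtains H where "symmetric_op H" "bounded_clinear H" "\<And>u v. h u v = cinner u (H v)"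
proof -
  have "\<exists>z. \<forall>u. h v u = cinner z u" for v
  proof -
    obtain z where "\<And>u. h v u = cinner z u"
      by (rule cinner.Riesz_representation[of "h v" "\<beta> * norm v"])
        (use h(1) bound[of v] in \<open>auto simp: sesquilinear_form_def cinner_self\<close>)
    then show ?thesis by blast
  qed
  then obtain H where H: "\<And>u v. h v u = cinner (H v) u" by metis
  have hH: "h u v = cinner u (H v)" for u v
  proof -
    have "h u v = cnj (h v u)" using h(2) unfolding symmetric_form_def by blast
    then show ?thesis using H cinner_commute by metis
  qed
  have sym: "symmetric_op H" by (simp add: symmetric_op_def H[symmetric] hH)
  have "norm (H v) \<le> \<beta> * norm v" for v
  proof (cases "H v = 0")
    case False
    \<comment> \<open>The bound on the form is tested with u = H v.\<close>
    have "(norm (H v))\<^sup>2 = cmod (h (H v) v)"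
      by (simp add: hH cinner_self norm_power)
    then have "norm (H v) * norm (H v) \<le> (\<beta> * norm v) * norm (H v)"
      using bound[of "H v" v] by (simp add: power2_eq_square mult_ac)
    then show ?thesis using False by simp
  qed (use \<open>0 \<le> \<beta>\<close> in simp)
  then have "bounded_clinear H" by (rule symmetric_op_bounded_clinear[OF sym])
  with that sym hH show thesis by blast
qed

text \<open>Coercivity and Cauchy-Schwarz give \<alpha> |x| \<le> |H x|. So \<open>H\<close> is
  injective with complete range; by symmetry the range is also dense, hence everything, and the
  inverse is bounded by 1/\<alpha>.\<close>

lemma coercive_boundedly_invertible:
  fixes H :: "'a::chilbert_space \<Rightarrow> 'a"
  assumes H: "symmetric_op H" "bounded_clinear H" and \<alpha>: "0 < \<alpha>"
    and coercive: "\<And>x. \<alpha> * (norm x)\<^sup>2 \<le> cmod (cinner x (H x))"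
  shows "boundedly_invertible H"
proof -
  have below: "\<alpha> * norm x \<le> norm (H x)" for x
  proof (cases "x = 0")
    case False
    have "(\<alpha> * norm x) * norm x \<le> norm (H x) * norm x"
      using coercive[of x] norm_cinner_le[of x "H x"] by (simp add: power2_eq_square mult_ac)
    then show ?thesis using False by simp
  qed simp
  have inj0: "x = 0" if "H x = 0" for x
    using below[of x] that \<alpha> by (simp add: mult_le_0_iff)
  note inj = symmetric_op_inj[OF H(1) inj0]
  have "complete (range H)"
    using complete_isometric_image[of \<alpha> UNIV H] \<alpha> below H(2)
    by (simp add: bounded_clinear_def mult.commute complete_UNIV)
  then have "range H = UNIV"
    using dense_range[OF H(1) inj0] complete_imp_closed closure_closed by blast
  then have HK: "H (inv H x) = x" for x by (simp add: surj_f_inv_f)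
  have KH: "inv H (H x) = x" for x using inj by simp
  have "symmetric_op (inv H)"
    unfolding symmetric_op_def using symmetric_opD[OF H(1)] HK by metis
  moreover have "norm (inv H x) \<le> (1 / \<alpha>) * norm x" for x
    using below[of "inv H x"] \<alpha> by (simp add: HK field_simps)
  ultimately have "bounded_clinear (inv H)" by (rule symmetric_op_bounded_clinear)
  then show ?thesis
    unfolding boundedly_invertible_def by (intro exI[of _ "inv H"]) (auto simp: HK KH)
qed

theorem theorem2p7:
  fixes D :: "'a::chilbert_space set"
    and a b :: "'a \<Rightarrow> 'a \<Rightarrow> complex"
    and A :: "'a partial_op"
    and \<alpha> \<beta> :: real
  assumes "sesquilinear_form D a"
    and "closure D = UNIV"
    and "symmetric_form D a"
    and "positive_definite_form D a"
    and "closed_form D a"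
    and "A = associated_op D a"
    and "sesquilinear_form D b"
    and "symmetric_form D b"
    and "0 < \<alpha>" and "\<alpha> \<le> \<beta>"
    and "\<And>x y. x \<in> D \<Longrightarrow> y \<in> D \<Longrightarrow>
           cmod (b x y) \<le> \<beta> * sqrt (Re (a x x)) * sqrt (Re (a y y))"
    and "\<And>x. x \<in> D \<Longrightarrow> cmod (b x x) \<ge> \<alpha> * Re (a x x)"
  shows "D = dom (op_sqrt A) \<and>
    (\<exists>!H. bounded_clinear H \<and> boundedly_invertible H \<and> self_adjoint (\<lambda>x. Some (H x)) \<and>
       (\<forall>x\<in>D. \<forall>y\<in>D. b x y = cinner (the (op_sqrt A x)) (H (the (op_sqrt A y)))))"
proof -
  interpret closed_positive_form D a
    by (rule closed_positive_formI) (fact assms)+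
  obtain Q where Q: "symmetric_op Q" "\<And>x. Q x = 0 \<Longrightarrow> x = 0"
    and sqrtA: "op_sqrt A = inverse_op Q" and range: "range Q = D"
    and aQ: "\<And>u v. a (Q u) (Q v) = cinner u v"
    using second_representation[OF assms(2)] unfolding assms(6) by blast
  note inj = symmetric_op_inj[OF Q]
  have QD: "Q u \<in> D" for u using range by blast
  \<comment> \<open>Substitution x = Q u, y = Q v: \<open>Q\<close> maps the whole space bijectively
    onto \<open>D\<close>, and the square root of \<open>A\<close> undoes it.\<close>
  have b_iff: "(\<forall>x\<in>D. \<forall>y\<in>D. b x y = cinner (the (op_sqrt A x)) (H (the (op_sqrt A y))))
      \<longleftrightarrow> (\<forall>u v. b (Q u) (Q v) = cinner u (H v))" for H
    unfolding range[symmetric] sqrtA using inj by simp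
  have "sesquilinear_form UNIV (\<lambda>u v. b (Q u) (Q v))"
    using assms(7) QD
    by (simp add: sesquilinear_form_def csubspace_UNIV symmetric_op_add[OF Q(1)]
      symmetric_op_scaleC[OF Q(1)])
  moreover have "symmetric_form UNIV (\<lambda>u v. b (Q u) (Q v))"
    using assms(8) QD unfolding symmetric_form_def by blast
  moreover have "cmod (b (Q u) (Q v)) \<le> \<beta> * norm u * norm v" for u v
    using assms(11)[OF QD QD, of u v] by (simp add: aQ cinner_self)
  moreover have "0 \<le> \<beta>" using assms(9,10) by simp
  ultimately obtain H where H: "symmetric_op H" "bounded_clinear H"
    "\<And>u v. b (Q u) (Q v) = cinner u (H v)"
    using bounded_symmetric_form_representation[of "\<lambda>u v. b (Q u) (Q v)" \<beta>] by blast
  \<comment> \<open>Since a[Q x, Q x] = |x|^2, coercivity relative to the form becomes coercivity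
    relative to the norm.\<close>
  have "\<alpha> * (norm x)\<^sup>2 \<le> cmod (cinner x (H x))" for x
    using assms(12)[OF QD, of x] by (simp add: aQ cinner_self H(3))
  then have "boundedly_invertible H"
    by (rule coercive_boundedly_invertible[OF H(1,2) assms(9)])
  \<comment> \<open>The values <u, H' v> for all \<open>u\<close> determine H' v, so the
    representation alone forces uniqueness.\<close>
  moreover have "H' = H" if "\<forall>u v. b (Q u) (Q v) = cinner u (H' v)" for H'
  proof
    fix v
    show "H' v = H v" by (rule cinner_eqI_right) (metis H(3) that)
  qed
  ultimately have "\<exists>!H. bounded_clinear H \<and> boundedly_invertible H \<and>
      self_adjoint (\<lambda>x. Some (H x)) \<and> (\<forall>u v. b (Q u) (Q v) = cinner u (H v))"
    using H by (intro ex1I[of _ H]) (auto simp: self_adjoint_total_iff)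
  then show ?thesis
    unfolding b_iff by (simp add: sqrtA dom_inverse_op range)
qed

end
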